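(* Let $k\ge 1$ and let $D$ and $D'$ be two diagrams, with virtual crossing types in $\{\alpha_1,\dots,\alpha_k\}$, of the same oriented multi-virtual knot. Then $W_D(t_1,\dots,t_k)=W_{D'}(t_1,\dots,t_k)$ in $\mathbb{Z}[t_1^{\pm1},\dots,t_k^{\pm1}]$. In other words, the multivariate writhe polynomial $W_D(t_1,\dots,t_k)$ does not depend on the choice of the diagram $D$ and is an invariant of multi-virtual knots.
   Context: Fix a finite set of types $\mathcal{T}=\{\alpha_1,\dots,\alpha_k\}$. An oriented multi-virtual knot diagram is a generic immersion of an oriented circle in the plane (finitely many transverse double points) in which every double point is either a classical crossing (with over/under information) or a virtual crossing labelled by one type in $\mathcal{T}$; not every type has to occur. Two diagrams are equivalent if they are related by a finite sequence of planar isotopies, the classical Reidemeister moves $\Omega_1,\Omega_2,\Omega_3$ (involving only classical crossings) and the multi-virtual Reidemeister moves: $\Omega_1^v$ (add/remove a kink whose crossing is virtual of type $\alpha_i$); $\Omega_2^v$ (add/remove a bigon whose two crossings are both virtual of the same type $\alpha_i$); $\Omega_3^v$ (a strand having virtual crossings of type $\alpha_i$ with two other strands is slid across the virtual crossing of type $\alpha_j$ of those two strands, where $i=j$ is allowed); $\Omega_3^{cv}$ (a strand having virtual crossings of the same type $\alpha_i$ with two other strands is slid across the classical crossing of those two strands). An oriented multi-virtual knot is an equivalence class of such diagrams. Gauss diagram $G(D)$ with virtual chords: take the round circle in the plane oriented anticlockwise, parametrizing $D$. For each classical crossing draw a chord joining its two preimages, directed from the preimage of the overcrossing to the preimage of the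 undercrossing, and carrying the sign $w(c)=\pm1$ of the crossing. For each virtual crossing of type $\alpha_i$ draw a virtual chord labelled $\alpha_i$ joining its two preimages, directed from the over- to the under-preimage of the positive classical crossing obtained by replacing the virtual crossing with a positive classical crossing. All chords are straight segments. A directed chord crosses a directed chord $c$ from left to right if it intersects $c$, its tail is on the left of $c$ and its head is on the right of $c$; similarly for right to left. For a classical chord $c$ let $l_{\alpha_i}(c)$ (resp. $r_{\alpha_i}(c)$) be the number of virtual chords of type $\alpha_i$ crossing $c$ from right to left (resp. from left to right), and set $\operatorname{Ind}_{\alpha_i}(c)=l_{\alpha_i}(c)-r_{\alpha_i}(c)$. Let $w(D)=\sum_c w(c)$ be the sum over classical crossings. The multivariate writhe polynomial of $D$ is $$W_D(t_1,\dots,t_k)=\sum_{c}w(c)\prod_{i=1}^k t_i^{\operatorname{Ind}_{\alpha_i}(c)}-w(D),$$ the sum being over all classical crossings $c$ of $D$. *)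

theory Defs
  imports "HOL-Analysis.Analysis" "HOL-Library.Poly_Mapping"
begin

section \<open>Diagrams\<close>

text \<open>
  The finite set of types of virtual crossings is a type variable \<open>'a :: finite\<close>, so
  that the number \<open>k\<close> of types is \<open>CARD('a)\<close>, an arbitrary positive integer.

  The plane is \<^typ>\<open>complex\<close>.  The oriented circle is \<open>\<real>/\<int>\<close>, so a closed curve is a
  1-periodic function on \<^typ>\<open>real\<close>.  The crossing data are attached to the preimages of the
  double points: the two preimages of a classical crossing are marked \<open>Over\<close> and \<open>Under\<close>,
  those of a virtual crossing of type \<open>i\<close> are both marked \<open>Virtual i\<close>.  The mark of a
  parameter that is not a preimage of a double point has no meaning.
\<close>

datatype 'a mark = Over | Under | Virtual 'a

record 'a diagram =
  curve :: "real \<Rightarrow> complex"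
  mark :: "real \<Rightarrow> 'a mark"

definition tangent :: "'a diagram \<Rightarrow> real \<Rightarrow> complex" where
  "tangent D t = vector_derivative (curve D) (at t)"

definition det2 :: "complex \<Rightarrow> complex \<Rightarrow> real" where
  "det2 u v = Re u * Im v - Im u * Re v"

definition crossing :: "'a diagram \<Rightarrow> real \<Rightarrow> real \<Rightarrow> bool" where
  "crossing D s t \<longleftrightarrow> s \<in> {0..<1} \<and> t \<in> {0..<1} \<and> s \<noteq> t \<and> curve D s = curve D t"

text \<open>
  A generic immersion is taken of class \<open>C\<^sup>1\<close>, and so are planar isotopies and
  reparametrizations; smooth diagrams related by smooth isotopies and moves are covered.
\<close>

definition is_diagram :: "'a diagram \<Rightarrow> bool" where
  "is_diagram D \<longleftrightarrow>
     curve D C1_differentiable_on UNIV \<and>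
     (\<forall>t. curve D (t + 1) = curve D t \<and> mark D (t + 1) = mark D t) \<and>
     (\<forall>t. tangent D t \<noteq> 0) \<and>
     finite {(s, t). crossing D s t} \<and>
     (\<forall>s t u. crossing D s t \<and> crossing D s u \<longrightarrow> t = u) \<and>
     (\<forall>s t. crossing D s t \<longrightarrow>
        det2 (tangent D s) (tangent D t) \<noteq> 0 \<and>
        ((mark D s = Over \<and> mark D t = Under) \<or>
         (mark D s = Under \<and> mark D t = Over) \<or>
         (\<exists>i. mark D s = Virtual i \<and> mark D t = Virtual i)))"


section \<open>Planar isotopies and Reidemeister moves\<close>

definition reparametrized :: "'a diagram \<Rightarrow> 'a diagram \<Rightarrow> bool" where
  "reparametrized D D' \<longleftrightarrow>
     (\<exists>\<rho> :: real \<Rightarrow> real.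
        \<rho> C1_differentiable_on UNIV \<and> (\<forall>t. deriv \<rho> t > 0) \<and> (\<forall>t. \<rho> (t + 1) = \<rho> t + 1) \<and>
        (\<forall>t. curve D' t = curve D (\<rho> t)) \<and>
        (\<forall>s t. crossing D' s t \<longrightarrow> mark D' s = mark D (\<rho> s)))"

definition ambient_isotopy :: "(real \<Rightarrow> complex \<Rightarrow> complex) \<Rightarrow> bool" where
  "ambient_isotopy H \<longleftrightarrow>
     H 0 = id \<and> (\<forall>s\<in>{0..1}. bij (H s)) \<and>
     continuous_on ({0..1} \<times> UNIV) (\<lambda>(s, z). H s z) \<and>
     (\<exists>H'. (\<forall>s\<in>{0..1}. \<forall>z. (H s has_derivative H' s z) (at z) \<and> bij (H' s z)) \<and>
           (\<forall>v. continuous_on ({0..1} \<times> UNIV) (\<lambda>(s, z). H' s z v)))"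

definition isotoped :: "'a diagram \<Rightarrow> 'a diagram \<Rightarrow> bool" where
  "isotoped D D' \<longleftrightarrow>
     (\<exists>H. ambient_isotopy H \<and> (\<forall>t. curve D' t = H 1 (curve D t)) \<and>
          (\<forall>s t. crossing D' s t \<longrightarrow> mark D' s = mark D s))"

text \<open>
  In every Reidemeister move a single strand, parametrized by \<open>{a..b}\<close>, is replaced by another
  one; both lie in the closed square \<open>square\<close>, and the rest of the diagram does not change.
  By a planar isotopy and a change of the base point, every move can be brought to the
  positions described below.
\<close>

definition square :: "complex set" where
  "square = {z. \<bar>Re z\<bar> \<le> 1 \<and> \<bar>Im z\<bar> \<le> 1}"

definition graph_over :: "(real \<Rightarrow> real) \<Rightarrow> complex set" where
  "graph_over f = (\<lambda>x. Complex x (f x)) ` {-1..1}"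

definition strand :: "'a diagram \<Rightarrow> real \<Rightarrow> real \<Rightarrow> complex set \<Rightarrow> bool" where
  "strand D a b S \<longleftrightarrow> 0 < a \<and> a < b \<and> b < 1 \<and> bij_betw (curve D) {a..b} S"

definition meets_square_in :: "'a diagram \<Rightarrow> real set \<Rightarrow> bool" where
  "meets_square_in D T \<longleftrightarrow> (\<forall>t\<in>{0..1}. curve D t \<in> square \<longleftrightarrow> t \<in> T)"

definition same_away_from :: "real \<Rightarrow> real \<Rightarrow> 'a diagram \<Rightarrow> 'a diagram \<Rightarrow> bool" where
  "same_away_from a b D D' \<longleftrightarrow>
     (\<forall>t\<in>{0..1} - {a<..<b}. curve D' t = curve D t) \<and>
     (\<forall>s t. crossing D s t \<and> s \<notin> {a..b} \<and> t \<notin> {a..b} \<longrightarrow> mark D' s = mark D s)"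

definition crossings_marked :: "'a diagram \<Rightarrow> real \<Rightarrow> real \<Rightarrow> 'a mark \<Rightarrow> bool" where
  "crossings_marked D a b m \<longleftrightarrow> (\<forall>s\<in>{a..b}. \<forall>t. crossing D s t \<longrightarrow> mark D s = m)"

text \<open>
  Adding a kink.  The square contains nothing but one simple arc of \<open>D\<close>, which is replaced by an
  arc with exactly one double point.  By the Jordan curve theorem the two ends of the new
  arc lie outside its loop, so it is a curl; both sides and both rotation directions of the loop
  are included.  The preimages of the new crossing, in the order along the strand, are \<open>s < t\<close>,
  and \<open>m\<close> is the mark of the first one.
\<close>

definition kink_move :: "'a mark \<Rightarrow> 'a diagram \<Rightarrow> 'a diagram \<Rightarrow> bool" where
  "kink_move m D D' \<longleftrightarrow>
     (\<exists>a b s t. 0 < a \<and> a < b \<and> b < 1 \<and>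
        meets_square_in D {a..b} \<and> meets_square_in D' {a..b} \<and> same_away_from a b D D' \<and>
        inj_on (curve D) {a..b} \<and>
        s < t \<and> {(u, v). crossing D' u v \<and> u \<in> {a..b} \<and> v \<in> {a..b}} = {(s, t), (t, s)} \<and>
        mark D' s = m)"

text \<open>
  Adding a bigon.  The square contains two strands: the horizontal diameter, and a strand
  that passes above it in \<open>D\<close>, and crosses it exactly twice in \<open>D'\<close>.  At both crossings
  the mark on the moving strand is \<open>m\<close>.  Either strand may run in either direction.
\<close>

definition bigon_move :: "'a mark \<Rightarrow> 'a diagram \<Rightarrow> 'a diagram \<Rightarrow> bool" where
  "bigon_move m D D' \<longleftrightarrow>
     (\<exists>a b c d f g. {a..b} \<inter> {c..d} = {} \<and>
        meets_square_in D ({a..b} \<union> {c..d}) \<and> meets_square_in D' ({a..b} \<union> {c..d}) \<and>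
        same_away_from a b D D' \<and>
        strand D c d {z \<in> square. Im z = 0} \<and>
        strand D a b (graph_over f) \<and> f C1_differentiable_on {-1..1} \<and>
        strand D' a b (graph_over g) \<and> g C1_differentiable_on {-1..1} \<and>
        (\<forall>x\<in>{-1..1}. f x > 0) \<and> card {x \<in> {-1..1}. g x = 0} = 2 \<and>
        crossings_marked D' a b m)"

text \<open>
  Sliding a strand across a crossing.  The square contains its two diagonals, crossing at the
  centre, and a third strand that crosses each diagonal exactly once, and passes above the
  centre in \<open>D\<close>, and below it in \<open>D'\<close>; the Lipschitz condition ensures that there are no further
  crossings.  At both its crossings the mark on the moving strand is \<open>m\<close>, and
  \<open>n\<close> is the mark of one of the preimages of the crossing at the centre.
\<close>

definition triangle_move :: "'a mark \<Rightarrow> 'a mark \<Rightarrow> 'a diagram \<Rightarrow> 'a diagram \<Rightarrow> bool" where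
  "triangle_move m n D D' \<longleftrightarrow>
     (\<exists>a b c d e h f g.
        {a..b} \<inter> {c..d} = {} \<and> {a..b} \<inter> {e..h} = {} \<and> {c..d} \<inter> {e..h} = {} \<and>
        meets_square_in D ({a..b} \<union> {c..d} \<union> {e..h}) \<and>
        meets_square_in D' ({a..b} \<union> {c..d} \<union> {e..h}) \<and>
        same_away_from a b D D' \<and>
        strand D c d {z \<in> square. Im z = Re z} \<and>
        strand D e h {z \<in> square. Im z = - Re z} \<and>
        strand D a b (graph_over f) \<and> f C1_differentiable_on {-1..1} \<and>
        strand D' a b (graph_over g) \<and> g C1_differentiable_on {-1..1} \<and>
        (\<forall>x\<in>{-1..1}. \<bar>f x\<bar> < 1 \<and> \<bar>deriv f x\<bar> < 1 \<and> \<bar>g x\<bar> < 1 \<and> \<bar>deriv g x\<bar> < 1) \<and>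
        f 0 > 0 \<and> g 0 < 0 \<and>
        crossings_marked D a b m \<and> crossings_marked D' a b m \<and>
        (\<forall>t\<in>{c..d}. curve D t = 0 \<longrightarrow> mark D t = n))"

text \<open>
  In a classical third move the three strands lie at three different heights.  The moving
  strand is taken to be the top one or the bottom one; no condition on the
  crossing of the other two is then needed.
\<close>

inductive move :: "'a diagram \<Rightarrow> 'a diagram \<Rightarrow> bool" where
  Reparametrization: "reparametrized D D' \<Longrightarrow> move D D'"
| Isotopy: "isotoped D D' \<Longrightarrow> move D D'"
| Omega1: "kink_move m D D' \<Longrightarrow> m \<in> {Over, Under} \<Longrightarrow> move D D'"
| Omega2: "bigon_move m D D' \<Longrightarrow> m \<in> {Over, Under} \<Longrightarrow> move D D'"
| Omega3: "triangle_move m n D D' \<Longrightarrow> m \<in> {Over, Under} \<Longrightarrow> n \<in> {Over, Under} \<Longrightarrow> move D D'"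
| Omega1v: "kink_move (Virtual i) D D' \<Longrightarrow> move D D'"
| Omega2v: "bigon_move (Virtual i) D D' \<Longrightarrow> move D D'"
| Omega3v: "triangle_move (Virtual i) (Virtual j) D D' \<Longrightarrow> move D D'"
| Omega3cv: "triangle_move (Virtual i) n D D' \<Longrightarrow> n \<in> {Over, Under} \<Longrightarrow> move D D'"

definition equivalent :: "'a diagram \<Rightarrow> 'a diagram \<Rightarrow> bool" where
  "equivalent = equivclp (\<lambda>D D'. is_diagram D \<and> is_diagram D' \<and> move D D')"

definition multi_virtual_knots :: "'a diagram set set" where
  "multi_virtual_knots =
     {D. is_diagram D} // {(D, D'). is_diagram D \<and> is_diagram D' \<and> equivalent D D'}"


section \<open>The Gauss diagram\<close>

text \<open>
  A directed chord is represented by the pair of the parameters of its tail and its head.  At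
  a positive crossing the tangents of the overcrossing and the undercrossing branch, in this
  order, form a positively oriented basis; this also gives the direction of the virtual chords.
\<close>

definition classical_chords :: "'a diagram \<Rightarrow> (real \<times> real) set" where
  "classical_chords D = {(s, t). crossing D s t \<and> mark D s = Over \<and> mark D t = Under}"

definition chord_sign :: "'a diagram \<Rightarrow> real \<times> real \<Rightarrow> int" where
  "chord_sign D c = (if det2 (tangent D (fst c)) (tangent D (snd c)) > 0 then 1 else - 1)"

definition virtual_chords :: "'a diagram \<Rightarrow> 'a \<Rightarrow> (real \<times> real) set" where
  "virtual_chords D i =
     {(s, t). crossing D s t \<and> mark D s = Virtual i \<and> mark D t = Virtual i \<and>
              det2 (tangent D s) (tangent D t) > 0}"

definition circle_point :: "real \<Rightarrow> complex" where
  "circle_point t = cis (2 * pi * t)"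

definition chord_segment :: "real \<times> real \<Rightarrow> complex set" where
  "chord_segment c = closed_segment (circle_point (fst c)) (circle_point (snd c))"

definition on_left :: "real \<times> real \<Rightarrow> real \<Rightarrow> bool" where
  "on_left c t \<longleftrightarrow>
     det2 (circle_point (snd c) - circle_point (fst c)) (circle_point t - circle_point (fst c)) > 0"

definition on_right :: "real \<times> real \<Rightarrow> real \<Rightarrow> bool" where
  "on_right c t \<longleftrightarrow>
     det2 (circle_point (snd c) - circle_point (fst c)) (circle_point t - circle_point (fst c)) < 0"

definition crosses_left_to_right :: "real \<times> real \<Rightarrow> real \<times> real \<Rightarrow> bool" where
  "crosses_left_to_right v c \<longleftrightarrow>
     chord_segment v \<inter> chord_segment c \<noteq> {} \<and> on_left c (fst v) \<and> on_right c (snd v)"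

definition crosses_right_to_left :: "real \<times> real \<Rightarrow> real \<times> real \<Rightarrow> bool" where
  "crosses_right_to_left v c \<longleftrightarrow>
     chord_segment v \<inter> chord_segment c \<noteq> {} \<and> on_right c (fst v) \<and> on_left c (snd v)"

definition l_count :: "'a diagram \<Rightarrow> 'a \<Rightarrow> real \<times> real \<Rightarrow> nat" where
  "l_count D i c = card {v \<in> virtual_chords D i. crosses_right_to_left v c}"

definition r_count :: "'a diagram \<Rightarrow> 'a \<Rightarrow> real \<times> real \<Rightarrow> nat" where
  "r_count D i c = card {v \<in> virtual_chords D i. crosses_left_to_right v c}"

definition Ind :: "'a diagram \<Rightarrow> 'a \<Rightarrow> real \<times> real \<Rightarrow> int" where
  "Ind D i c = int (l_count D i c) - int (r_count D i c)"


section \<open>The multivariate writhe polynomial\<close>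

text \<open>
  The ring of Laurent polynomials over the integers, in variables indexed by \<open>'a\<close>, is the group
  ring of the free abelian group on \<open>'a\<close>, whose elements are the exponent vectors.
\<close>

type_synonym 'a laurent = "('a \<Rightarrow>\<^sub>0 int) \<Rightarrow>\<^sub>0 int"

definition var_power :: "'a \<Rightarrow> int \<Rightarrow> 'a laurent" where
  "var_power i n = Poly_Mapping.single (Poly_Mapping.single i n) 1"

definition writhe :: "'a diagram \<Rightarrow> int" where
  "writhe D = (\<Sum>c\<in>classical_chords D. chord_sign D c)"

definition writhe_polynomial :: "('a :: finite) diagram \<Rightarrow> 'a laurent" where
  "writhe_polynomial D =
     (\<Sum>c\<in>classical_chords D. of_int (chord_sign D c) * (\<Prod>i\<in>UNIV. var_power i (Ind D i c)))
       - of_int (writhe D)"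

end

theory Submission
  imports Defs
begin

text \<open>
  Weight the head of every virtual chord of type \<open>i\<close> by \<open>1\<close> and its tail by \<open>-1\<close>.  As the total
  weight is zero, the weight of the arc from the base point to \<open>u\<close> is a potential on the circle,
  and the index of a classical chord is the difference of the potentials at its tail and its head.
  A reparametrization changes the potential by a constant.  A Reidemeister move replaces the
  preimages on each strand in the square by others of the same total weight, so the potential does
  not change outside the strands.  Inside, the chord of a kink has
  index 0, the chords of a classical bigon have equal indices and opposite signs, and in a classical
  triangle move the potential is constant on each strand.  When a virtual strand
  slides across a classical crossing, the potentials at the two preimages of that crossing change
  by the same amount.
\<close>

section \<open>The Gauss diagram in terms of parameters\<close>

text \<open>The local moves preserve the weight of each strand for three different reasons. In a
  kink both preimages lie on one strand and their weights cancel. In a bigon the two crossings have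
  opposite signs, since the moving graph descends through its first zero and ascends through its
  second. In a triangle the slope of the moving graph is smaller in absolute value than that of the
  diagonals, so its crossing signs depend on the directions of the strands alone. Subtracting the
  writhe makes every classical crossing contribute its sign times the difference of its monomial and
  1. A crossing of index 0 then contributes nothing, which is what a classical kink requires. Each
  double point is kept as two ordered pairs of parameters, and reversing a pair negates its sign.
  Weights and classical terms thus become sums over the same set of pairs, and a moving strand on
  top and one at the bottom are treated alike.\<close>

lemma det2_circle_point:
  "det2 (circle_point b - circle_point a) (circle_point c - circle_point a) =
     4 * sin (pi * (b - a)) * sin (pi * (c - b)) * sin (pi * (c - a))"
proof -
  define A B C where "A = pi * a" and "B = pi * b" and "C = pi * c"
  have 1: "pi * (b - a) = B - A" "pi * (c - b) = C - B" "pi * (c - a) = C - A"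
    by (simp_all add: A_def B_def C_def algebra_simps)
  have 2: "2 * pi * a = 2 * A" "2 * pi * b = 2 * B" "2 * pi * c = 2 * C"
    by (simp_all add: A_def B_def C_def)
  have s: "(sin x)\<^sup>2 = 1 - (cos x)\<^sup>2" for x :: real
    by (simp add: sin_squared_eq)
  \<comment> \<open>This is twice the signed area of a triangle inscribed in the unit circle, which
    is half the product of its sides, such as \<open>2 * \<bar>sin (pi * (b - a))\<bar>\<close>; the
    signs of the sines record the orientation.\<close>
  show ?thesis
    unfolding det2_def circle_point_def 1 2
    apply (simp add: sin_diff sin_double cos_double)
    using s[of A] s[of B] s[of C] by algebra
qed

lemma sin_pi_mult_pos_iff:
  assumes "\<bar>d\<bar> < 1"
  shows "sin (pi * d) > 0 \<longleftrightarrow> d > 0" "sin (pi * d) < 0 \<longleftrightarrow> d < 0"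
proof -
  have pos: "sin (pi * x) > 0" if "0 < x" "x < 1" for x
    using that by (intro sin_gt_zero) auto
  have neg: "sin (pi * x) < 0" if "x < 0" "- 1 < x" for x
    using pos[of "- x"] that by simp
  consider "d = 0" | "d > 0" | "d < 0" by linarith
  then have "(sin (pi * d) > 0 \<longleftrightarrow> d > 0) \<and> (sin (pi * d) < 0 \<longleftrightarrow> d < 0)"
    using pos[of d] neg[of d] assms by cases auto
  then show "sin (pi * d) > 0 \<longleftrightarrow> d > 0" "sin (pi * d) < 0 \<longleftrightarrow> d < 0" by auto
qed

text \<open>Parameters in the fundamental interval differ by less than 1, so each sine has the sign
  of its difference. Being on the left means that \<open>p\<close>, \<open>q\<close>,
  \<open>x\<close> follow each other anticlockwise; the three disjuncts are the possible places of
  the base point in this cyclic order.\<close>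

lemma on_side_iff:
  assumes "p \<in> {0..<1}" "q \<in> {0..<1}" "x \<in> {0..<1}"
  shows "on_left (p, q) x \<longleftrightarrow> (p < q \<and> q < x) \<or> (q < x \<and> x < p) \<or> (x < p \<and> p < q)"
    and "on_right (p, q) x \<longleftrightarrow> (p < x \<and> x < q) \<or> (x < q \<and> q < p) \<or> (q < p \<and> p < x)"
proof -
  have small: "\<bar>q - p\<bar> < 1" "\<bar>x - q\<bar> < 1" "\<bar>x - p\<bar> < 1"
    using assms by auto
  note sg = small[THEN sin_pi_mult_pos_iff(1)] small[THEN sin_pi_mult_pos_iff(2)]
  show "on_left (p, q) x \<longleftrightarrow> (p < q \<and> q < x) \<or> (q < x \<and> x < p) \<or> (x < p \<and> p < q)"
    unfolding on_left_def fst_conv snd_conv det2_circle_point zero_less_mult_iff mult_less_0_iff sg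
    by auto
  show "on_right (p, q) x \<longleftrightarrow> (p < x \<and> x < q) \<or> (x < q \<and> q < p) \<or> (q < p \<and> p < x)"
    unfolding on_right_def fst_conv snd_conv det2_circle_point zero_less_mult_iff mult_less_0_iff sg
    by auto
qed

lemma norm_circle_point [simp]: "norm (circle_point t) = 1"
  by (simp add: circle_point_def)

text \<open>
  The segment of \<open>v\<close> meets the line of \<open>c\<close> in a point of the unit disc.  That point lies on the
  segment of \<open>c\<close>, because the squared norm is strictly convex along the line.
\<close>

lemma chord_segments_meet:
  assumes "on_left c (fst v) \<and> on_right c (snd v) \<or> on_right c (fst v) \<and> on_left c (snd v)"
  shows "chord_segment v \<inter> chord_segment c \<noteq> {}"
proof -
  define x y where "x = circle_point (fst c)" and "y = circle_point (snd c)"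
  define a b where "a = circle_point (fst v)" and "b = circle_point (snd v)"
  define h where "h z = det2 (y - x) (z - x)" for z
  have sides: "h a > 0 \<and> h b < 0 \<or> h a < 0 \<and> h b > 0"
    using assms by (simp add: on_left_def on_right_def h_def x_def y_def a_def b_def)
  define u where "u = h a / (h a - h b)"
  have u: "0 \<le> u" "u \<le> 1" "h a - h b \<noteq> 0"
    using sides by (auto simp: u_def divide_simps)
  define z where "z = (1 - u) *\<^sub>R a + u *\<^sub>R b"
  have "h z = (1 - u) * h a + u * h b"
    by (simp add: h_def z_def det2_def algebra_simps)
  also have "\<dots> = 0"
    using u(3) by (simp add: u_def field_simps)
  finally have hz: "h z = 0" .
  have xy: "x \<noteq> y"
    using sides by (auto simp: h_def det2_def)
  have z_seg: "z \<in> chord_segment v"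
    unfolding chord_segment_def closed_segment_def a_def[symmetric] b_def[symmetric]
    using u z_def by auto
  have "norm z \<le> (1 - u) * norm a + u * norm b"
    unfolding z_def using u by (metis abs_of_nonneg diff_ge_0_iff_ge norm_scaleR norm_triangle_ineq)
  then have nz: "norm z \<le> 1"
    by (simp add: a_def b_def)
  define w where "w = y - x"
  \<comment> \<open>The coefficient of the orthogonal projection of \<open>z - x\<close> onto
    \<open>w\<close>; it is exact because \<open>par\<close> makes the two vectors parallel.\<close>
  define l where "l = (Re w * Re (z - x) + Im w * Im (z - x)) / (norm w)\<^sup>2"
  have nw: "(norm w)\<^sup>2 = (Re w)\<^sup>2 + (Im w)\<^sup>2"
    by (rule cmod_power2)
  have nw_pos: "(norm w)\<^sup>2 > 0"
    using xy by (simp add: w_def)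
  have par: "Re w * Im (z - x) = Im w * Re (z - x)"
    using hz by (simp add: h_def det2_def w_def)
  have re: "Re (z - x) = l * Re w"
  proof -
    have "(norm w)\<^sup>2 * Re (z - x) = (Re w * Re (z - x) + Im w * Im (z - x)) * Re w"
      unfolding nw using par by algebra
    then show ?thesis using nw_pos by (simp add: l_def field_simps)
  qed
  have im: "Im (z - x) = l * Im w"
  proof -
    have "(norm w)\<^sup>2 * Im (z - x) = (Re w * Re (z - x) + Im w * Im (z - x)) * Im w"
      unfolding nw using par by algebra
    then show ?thesis using nw_pos by (simp add: l_def field_simps)
  qed
  have zl: "z = (1 - l) *\<^sub>R x + l *\<^sub>R y"
    using re im by (simp add: complex_eq_iff w_def algebra_simps)
  have "(norm z)\<^sup>2 \<le> 1"
    using nz by (simp add: power_le_one)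
  moreover have "(Re x)\<^sup>2 + (Im x)\<^sup>2 = 1" "(Re y)\<^sup>2 + (Im y)\<^sup>2 = 1"
    using norm_circle_point[of "fst c"] norm_circle_point[of "snd c"]
    by (metis cmod_power2 x_def power_one, metis cmod_power2 y_def power_one)
  \<comment> \<open>The scalar product of \<open>x\<close> and \<open>y\<close> is expressed through
    \<open>norm w\<close>. As \<open>x\<close> and \<open>y\<close> are unit vectors, the right-hand
    side is \<open>1 - l * (1 - l) * (norm w)\<^sup>2\<close>, so a point of the disc has
    \<open>l * (1 - l) \<ge> 0\<close>.\<close>
  moreover have "(norm z)\<^sup>2 = (1 - l)\<^sup>2 * ((Re x)\<^sup>2 + (Im x)\<^sup>2) + l\<^sup>2 * ((Re y)\<^sup>2 + (Im y)\<^sup>2)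
      + l * (1 - l) * ((Re x)\<^sup>2 + (Im x)\<^sup>2 + ((Re y)\<^sup>2 + (Im y)\<^sup>2) - (norm w)\<^sup>2)"
    unfolding nw cmod_power2 zl w_def by (simp add: power2_eq_square algebra_simps)
  ultimately have "1 - l * (1 - l) * (norm w)\<^sup>2 \<le> 1"
    by (simp add: power2_eq_square algebra_simps)
  then have "0 \<le> l * (1 - l)"
    using nw_pos by (simp add: zero_le_mult_iff)
  then have "0 \<le> l" "l \<le> 1"
    by (auto simp: zero_le_mult_iff)
  then have "z \<in> chord_segment c"
    unfolding chord_segment_def closed_segment_def x_def[symmetric] y_def[symmetric]
    using zl by auto
  with z_seg show ?thesis by auto
qed

lemma crosses_iff:
  "crosses_left_to_right v c \<longleftrightarrow> on_left c (fst v) \<and> on_right c (snd v)"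
  "crosses_right_to_left v c \<longleftrightarrow> on_right c (fst v) \<and> on_left c (snd v)"
  using chord_segments_meet[of c v]
  by (auto simp: crosses_left_to_right_def crosses_right_to_left_def)


section \<open>The index as a difference of potentials\<close>

text \<open>Both orders of a double point belong to this set, so in a diagram every preimage is the
  second component of exactly one pair.\<close>

definition crossings :: "'a diagram \<Rightarrow> (real \<times> real) set" where
  "crossings D = {(s, t). crossing D s t}"

fun partner_mark :: "'a mark \<Rightarrow> 'a mark" where
  "partner_mark Over = Under"
| "partner_mark Under = Over"
| "partner_mark (Virtual i) = Virtual i"

lemma crossing_sym: "crossing D s t \<longleftrightarrow> crossing D t s"
  by (auto simp: crossing_def)

lemma crossing_mark: "is_diagram D \<Longrightarrow> crossing D s t \<Longrightarrow> mark D t = partner_mark (mark D s)"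
  unfolding is_diagram_def by (metis partner_mark.simps)

lemma finite_crossings: "is_diagram D \<Longrightarrow> finite (crossings D)"
  by (simp add: is_diagram_def crossings_def)

lemma crossing_det: "is_diagram D \<Longrightarrow> crossing D s t \<Longrightarrow> det2 (tangent D s) (tangent D t) \<noteq> 0"
  unfolding is_diagram_def by blast

lemma det2_commute: "det2 u v = - det2 v u"
  by (simp add: det2_def)

lemma chord_sign_swap:
  assumes "is_diagram D" "crossing D s t"
  shows "chord_sign D (t, s) = - chord_sign D (s, t)"
  using crossing_det[OF assms] det2_commute[of "tangent D s" "tangent D t"]
  by (auto simp: chord_sign_def)

text \<open>
  Every preimage of a virtual crossing of type \<open>i\<close> is weighted by \<open>1\<close> if it is the head of its chord
  and by \<open>-1\<close> if it is the tail.
\<close>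

definition weight :: "'a diagram \<Rightarrow> 'a \<Rightarrow> real set \<Rightarrow> int" where
  "weight D i T =
     (\<Sum>(s, t)\<in>crossings D. if mark D s = Virtual i \<and> t \<in> T then chord_sign D (s, t) else 0)"

lemma sum_crossings_swap:
  "(\<Sum>(s, t)\<in>crossings D. h s t) = (\<Sum>(s, t)\<in>crossings D. h t s)"
proof -
  have "bij_betw prod.swap (crossings D) (crossings D)"
    by (rule bij_betwI[where g = prod.swap]) (auto simp: crossings_def crossing_sym)
  from sum.reindex_bij_betw[OF this, of "\<lambda>(s, t). h s t"]
  show ?thesis by (simp add: case_prod_unfold)
qed

text \<open>Exchanging the two preimages keeps a virtual mark and reverses the sign, so the sum
  equals its own negative.\<close>

lemma weight_UNIV:
  assumes "is_diagram D"
  shows "weight D i UNIV = 0"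
proof -
  let ?h = "\<lambda>s t. if mark D s = Virtual i then chord_sign D (s, t) else 0"
  have "(\<Sum>(s, t)\<in>crossings D. ?h s t) = (\<Sum>(s, t)\<in>crossings D. ?h t s)"
    by (rule sum_crossings_swap)
  also have "\<dots> = (\<Sum>(s, t)\<in>crossings D. - ?h s t)"
  proof (intro sum.cong refl, clarify)
    fix s t assume "(s, t) \<in> crossings D"
    then have c: "crossing D s t" by (simp add: crossings_def)
    have "mark D t = Virtual i \<longleftrightarrow> mark D s = Virtual i"
      using crossing_mark[OF assms c] by (cases "mark D s") auto
    then show "?h t s = - ?h s t" by (simp add: chord_sign_swap[OF assms c])
  qed
  also have "\<dots> = - (\<Sum>(s, t)\<in>crossings D. ?h s t)"
    by (simp add: case_prod_unfold sum_negf)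
  finally show ?thesis by (simp add: weight_def)
qed

lemma weight_Un:
  assumes "A \<inter> B = {}"
  shows "weight D i (A \<union> B) = weight D i A + weight D i B"
  unfolding weight_def sum.distrib[symmetric] using assms
  by (intro sum.cong) auto

lemma Ind_eq_weight:
  assumes D: "is_diagram D" and c: "(p, q) \<in> classical_chords D"
  shows "Ind D i (p, q) = weight D i {..<p} - weight D i {..<q}"
proof -
  define V where "V = virtual_chords D i"
  define b :: "bool \<Rightarrow> int" where "b P = of_bool P" for P
  \<comment> \<open>Away from \<open>p\<close> and \<open>q\<close>, where all ends of virtual
    chords lie, \<open>\<phi>\<close> is the indicator of the left side of the chord, up to an
    additive constant (-1 if \<open>p < q\<close>, and 0 otherwise). Its value at the head minus
    that at the tail therefore counts a crossing from right to left as 1 and one from left to right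
    as -1.\<close>
  define \<phi> where "\<phi> x = b (x < p) - b (x < q)" for x
  have V_sub: "V \<subseteq> crossings D"
    by (auto simp: V_def virtual_chords_def crossings_def)
  then have fin: "finite V"
    using finite_crossings[OF D] finite_subset by blast
  have cpq: "crossing D p q" "mark D p = Over" "mark D q = Under"
    using c by (auto simp: classical_chords_def)
  have pq: "p \<in> {0..<1}" "q \<in> {0..<1}" "p \<noteq> q"
    using cpq by (auto simp: crossing_def)
  have card_b: "int (card {v \<in> V. P v}) = (\<Sum>v\<in>V. b (P v))" for P
    using fin by (simp add: b_def Int_def flip: sum.inter_filter)
  have "Ind D i (p, q) =
      (\<Sum>v\<in>V. b (on_right (p, q) (fst v) \<and> on_left (p, q) (snd v)) -
              b (on_left (p, q) (fst v) \<and> on_right (p, q) (snd v)))"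
    unfolding Ind_def l_count_def r_count_def V_def[symmetric] crosses_iff card_b
    by (simp add: sum_subtractf)
  also have "\<dots> = (\<Sum>v\<in>V. \<phi> (snd v) - \<phi> (fst v))"
  proof (intro sum.cong refl, clarify)
    fix s t assume "(s, t) \<in> V"
    then have st: "s \<in> {0..<1}" "t \<in> {0..<1}" "mark D s = Virtual i" "mark D t = Virtual i"
      by (auto simp: V_def virtual_chords_def crossing_def)
    then have "s \<noteq> p" "s \<noteq> q" "t \<noteq> p" "t \<noteq> q"
      using cpq by auto
    with pq show "b (on_right (p, q) (fst (s, t)) \<and> on_left (p, q) (snd (s, t))) -
        b (on_left (p, q) (fst (s, t)) \<and> on_right (p, q) (snd (s, t))) = \<phi> (snd (s, t)) - \<phi> (fst (s, t))"
      unfolding fst_conv snd_conv on_side_iff[OF pq(1,2) st(1)] on_side_iff[OF pq(1,2) st(2)]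
      by (cases "p < q"; cases "s < p"; cases "s < q"; cases "t < p"; cases "t < q";
          simp add: \<phi>_def b_def)
  qed
  also have "\<dots> = (\<Sum>v\<in>V. \<phi> (snd v)) + (\<Sum>v\<in>V. - \<phi> (fst v))"
    by (simp add: sum.distrib sum_subtractf sum_negf)
  \<comment> \<open>Tails become second components of the reversed pairs, whose sign is -1; heads
    and tails then enter one signed sum.\<close>
  also have "(\<Sum>v\<in>V. - \<phi> (fst v)) = (\<Sum>v\<in>prod.swap ` V. - \<phi> (snd v))"
    by (subst sum.reindex) auto
  also have "(\<Sum>v\<in>V. \<phi> (snd v)) + (\<Sum>v\<in>prod.swap ` V. - \<phi> (snd v)) =
      (\<Sum>v\<in>V. chord_sign D v * \<phi> (snd v)) + (\<Sum>v\<in>prod.swap ` V. chord_sign D v * \<phi> (snd v))"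
  proof (intro arg_cong2[where f = "(+)"] sum.cong refl)
    fix v assume "v \<in> V"
    then show "\<phi> (snd v) = chord_sign D v * \<phi> (snd v)"
      by (auto simp: V_def virtual_chords_def chord_sign_def)
  next
    fix v assume "v \<in> prod.swap ` V"
    then show "- \<phi> (snd v) = chord_sign D v * \<phi> (snd v)"
      by (auto simp: V_def virtual_chords_def chord_sign_def det2_commute[of "tangent D (fst v)"]
          split: if_splits)
  qed
  also have "\<dots> = (\<Sum>v\<in>V \<union> prod.swap ` V. chord_sign D v * \<phi> (snd v))"
  proof (rule sum.union_disjoint[symmetric])
    have "det2 (tangent D t) (tangent D s) > 0 \<Longrightarrow> \<not> det2 (tangent D s) (tangent D t) > 0" for s t
      using det2_commute[of "tangent D s" "tangent D t"] by simp
    then show "V \<inter> prod.swap ` V = {}"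
      by (auto simp: V_def virtual_chords_def)
  qed (use fin in auto)
  \<comment> \<open>By transversality exactly one order of each virtual crossing has a positive
    determinant, so \<open>V\<close> and its reversal exhaust the pairs of type
    \<open>i\<close>.\<close>
  also have "V \<union> prod.swap ` V = {v \<in> crossings D. mark D (fst v) = Virtual i}"
  proof -
    have "(t, s) \<in> V" if "crossing D s t" "mark D s = Virtual i" "(s, t) \<notin> V" for s t
      using that crossing_det[OF D that(1)] crossing_mark[OF D that(1)]
        det2_commute[of "tangent D s" "tangent D t"] crossing_sym[of D s t]
      by (auto simp: V_def virtual_chords_def)
    moreover have "crossing D s t \<and> crossing D t s \<and> mark D s = Virtual i \<and> mark D t = Virtual i"
      if "(s, t) \<in> V" for s t
      using that crossing_sym[of D s t] by (auto simp: V_def virtual_chords_def)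
    moreover have "(s, t) \<in> prod.swap ` V \<longleftrightarrow> (t, s) \<in> V" for s t
      by (simp add: pair_in_swap_image)
    ultimately have "(s, t) \<in> V \<union> prod.swap ` V \<longleftrightarrow> crossing D s t \<and> mark D s = Virtual i" for s t
      by blast
    then show ?thesis
      by (intro set_eqI) (simp add: crossings_def split_paired_all)
  qed
  also have "(\<Sum>v\<in>\<dots>. chord_sign D v * \<phi> (snd v)) = weight D i {..<p} - weight D i {..<q}"
    unfolding weight_def sum_subtractf[symmetric] sum.inter_filter[OF finite_crossings[OF D]]
    by (intro sum.cong) (auto simp: \<phi>_def b_def)
  finally show ?thesis .
qed

section \<open>The polynomial as a sum over ordered crossings\<close>

definition monomial :: "('a :: finite \<Rightarrow> int) \<Rightarrow> 'a laurent" where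
  "monomial d = (\<Prod>i\<in>UNIV. var_power i (d i))"

lemma monomial_0: "monomial (\<lambda>_. 0) = 1"
  by (simp add: monomial_def var_power_def)

text \<open>Only the order from over to under contributes, so a sum over ordered pairs counts each
  classical crossing once. The \<open>- 1\<close> distributes the subtracted writhe over the
  crossings.\<close>

definition marked_term :: "'a mark \<Rightarrow> 'a mark \<Rightarrow> int \<Rightarrow> ('a :: finite \<Rightarrow> int) \<Rightarrow> 'a laurent" where
  "marked_term m n e d = (if m = Over \<and> n = Under then of_int e * (monomial d - 1) else 0)"

definition crossing_term :: "('a :: finite) diagram \<Rightarrow> real \<Rightarrow> real \<Rightarrow> 'a laurent" where
  "crossing_term D s t =
     marked_term (mark D s) (mark D t) (chord_sign D (s, t))
       (\<lambda>i. weight D i {..<s} - weight D i {..<t})"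

lemma writhe_polynomial_eq:
  fixes D :: "('a :: finite) diagram"
  assumes D: "is_diagram D"
  shows "writhe_polynomial D = (\<Sum>(s, t)\<in>crossings D. crossing_term D s t)"
proof -
  have cl: "classical_chords D = {c \<in> crossings D. mark D (fst c) = Over \<and> mark D (snd c) = Under}"
    by (auto simp: classical_chords_def crossings_def)
  have "writhe_polynomial D =
      (\<Sum>c\<in>classical_chords D. of_int (chord_sign D c) * (monomial (\<lambda>i. Ind D i c) - 1))"
    by (simp add: writhe_polynomial_def writhe_def monomial_def sum_subtractf algebra_simps)
  also have "\<dots> = (\<Sum>c\<in>classical_chords D. crossing_term D (fst c) (snd c))"
    using Ind_eq_weight[OF D]
    by (intro sum.cong refl)
       (auto simp: crossing_term_def marked_term_def classical_chords_def)
  also have "\<dots> = (\<Sum>(s, t)\<in>crossings D. crossing_term D s t)"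
    unfolding cl sum.inter_filter[OF finite_crossings[OF D]]
    by (intro sum.cong) (auto simp: crossing_term_def marked_term_def)
  finally show ?thesis .
qed

section \<open>Reparametrizations and isotopies\<close>

text \<open>Here \<open>\<theta>\<close> is the place in \<open>D\<close> of the base point of
  \<open>D'\<close>: the condition \<open>order\<close> says that the linear order in
  \<open>D'\<close> comes from cutting the cyclic order in \<open>D\<close> open at
  \<open>\<theta>\<close>. The potential then changes by the constant
  \<open>weight D i {..<\<theta>}\<close>, which cancels in every index.\<close>

lemma writhe_polynomial_transport:
  fixes D D' :: "('a :: finite) diagram" and \<phi> :: "real \<Rightarrow> real" and \<theta> :: real
  assumes D: "is_diagram D" and D': "is_diagram D'"
    and bij: "bij_betw (map_prod \<phi> \<phi>) (crossings D') (crossings D)"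
    and marks: "\<And>s t. crossing D' s t \<Longrightarrow> mark D' s = mark D (\<phi> s)"
    and signs: "\<And>s t. crossing D' s t \<Longrightarrow> chord_sign D' (s, t) = chord_sign D (\<phi> s, \<phi> t)"
    and order: "\<And>x y u v. crossing D' x y \<Longrightarrow> crossing D' u v \<Longrightarrow>
      (of_bool (x < u) :: int) = of_bool (\<phi> x < \<phi> u) - of_bool (\<phi> x < \<theta>) + of_bool (\<phi> u < \<theta>)"
  shows "writhe_polynomial D = writhe_polynomial D'"
proof -
  have weight_D: "weight D i S =
      (\<Sum>(s, t)\<in>crossings D'. if mark D' s = Virtual i \<and> \<phi> t \<in> S then chord_sign D' (s, t) else 0)"
    for i S
    unfolding weight_def sum.reindex_bij_betw[OF bij, symmetric]
    by (intro sum.cong) (auto simp: crossings_def marks signs)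
  have weight_D': "weight D' i {..<u} = weight D i {..<\<phi> u} - weight D i {..<\<theta>}"
    if u: "crossing D' u v" for i u v
  proof -
    \<comment> \<open>The correction \<open>of_bool (\<phi> u < \<theta>)\<close> does not depend on
      the summed preimage, so it multiplies the total weight, which is zero.\<close>
    have "weight D' i {..<u} =
      weight D i {..<\<phi> u} - weight D i {..<\<theta>} + of_bool (\<phi> u < \<theta>) * weight D i UNIV"
      unfolding weight_D sum_distrib_left sum_subtractf[symmetric] sum.distrib[symmetric]
      unfolding weight_def
    proof (intro sum.cong refl, clarify)
      fix s t assume "(s, t) \<in> crossings D'"
      then have "crossing D' t s" by (simp add: crossings_def crossing_sym)
      from order[OF this u]
      show "(if mark D' s = Virtual i \<and> t \<in> {..<u} then chord_sign D' (s, t) else 0) =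
        (if mark D' s = Virtual i \<and> \<phi> t \<in> {..<\<phi> u} then chord_sign D' (s, t) else 0) -
        (if mark D' s = Virtual i \<and> \<phi> t \<in> {..<\<theta>} then chord_sign D' (s, t) else 0) +
        of_bool (\<phi> u < \<theta>) *
          (if mark D' s = Virtual i \<and> \<phi> t \<in> UNIV then chord_sign D' (s, t) else 0)"
        by (auto simp: of_bool_def split: if_splits)
    qed
    then show ?thesis by (simp add: weight_UNIV[OF D])
  qed
  have "crossing_term D' s t = crossing_term D (\<phi> s) (\<phi> t)" if st: "crossing D' s t" for s t
  proof -
    have ts: "crossing D' t s" using st by (simp add: crossing_sym)
    show ?thesis
      unfolding crossing_term_def
      by (simp add: marks[OF st] marks[OF ts] signs[OF st] weight_D'[OF st] weight_D'[OF ts])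
  qed
  then show ?thesis
    unfolding writhe_polynomial_eq[OF D] writhe_polynomial_eq[OF D']
      sum.reindex_bij_betw[OF bij, symmetric]
    by (intro sum.cong) (auto simp: crossings_def)
qed

section \<open>Tangents, periodicity and reparametrizations\<close>

lemma has_tangent:
  assumes "is_diagram D"
  shows "(curve D has_vector_derivative tangent D t) (at t)"
  using assms unfolding is_diagram_def tangent_def C1_differentiable_on_eq
  by (simp add: vector_derivative_works)

lemma curve_mark_shift:
  assumes "is_diagram D"
  shows "curve D (t + of_int n) = curve D t \<and> mark D (t + of_int n) = mark D t"
proof (induction n rule: int_induct[where k = 0])
  case (step1 n)
  then show ?case
    using assms unfolding is_diagram_def by (metis add.assoc of_int_1 of_int_add)
next
  case (step2 n)
  then show ?case
    using assms unfolding is_diagram_def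
    by (metis (no_types, opaque_lifting) diff_add_cancel add.assoc of_int_1 of_int_add)
qed simp

lemma tangent_shift:
  assumes "is_diagram D"
  shows "tangent D (t + of_int n) = tangent D t"
proof -
  have "((\<lambda>x. curve D (x + of_int n)) has_vector_derivative 1 *\<^sub>R tangent D (t + of_int n)) (at t)"
    using vector_diff_chain_at[of "\<lambda>x. x + of_int n" 1 t "curve D"] has_tangent[OF assms]
    by (simp add: o_def has_vector_derivative_add_const)
  then have "(curve D has_vector_derivative tangent D (t + of_int n)) (at t)"
    using curve_mark_shift[OF assms] by simp
  then show ?thesis
    using has_tangent[OF assms] vector_derivative_unique_at by blast
qed

lemma det2_scaleR: "det2 (a *\<^sub>R u) (b *\<^sub>R v) = a * b * det2 u v"
  by (simp add: det2_def algebra_simps)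

lemma writhe_polynomial_reparametrized:
  fixes D D' :: "('a :: finite) diagram"
  assumes D: "is_diagram D" and D': "is_diagram D'" and "reparametrized D D'"
  shows "writhe_polynomial D = writhe_polynomial D'"
proof -
  obtain \<rho> :: "real \<Rightarrow> real" where C1: "\<rho> C1_differentiable_on UNIV"
    and pos: "\<And>t. deriv \<rho> t > 0" and per: "\<And>t. \<rho> (t + 1) = \<rho> t + 1"
    and curve: "\<And>t. curve D' t = curve D (\<rho> t)"
    and mark: "\<And>s t. crossing D' s t \<Longrightarrow> mark D' s = mark D (\<rho> s)"
    using assms(3) unfolding reparametrized_def by blast
  have der: "(\<rho> has_real_derivative deriv \<rho> t) (at t)" for t
    using C1 by (simp add: C1_differentiable_on_eq DERIV_deriv_iff_real_differentiable)
  have mono: "\<rho> x < \<rho> y \<longleftrightarrow> x < y" for x y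
  proof -
    have "\<rho> x < \<rho> y" if "x < y" for x y
      using DERIV_pos_imp_increasing[OF that] der pos by blast
    then show ?thesis by (metis less_asym less_linear)
  qed
  have per_int: "\<rho> (t + of_int n) = \<rho> t + of_int n" for t n
  proof (induction n rule: int_induct[where k = 0])
    case (step1 n)
    then show ?case using per[of "t + of_int n"] by (simp add: add.assoc)
  next
    case (step2 n)
    then show ?case using per[of "t + of_int (n - 1)"] by (simp add: algebra_simps)
  qed simp
  have surj: "\<exists>x. \<rho> x = y" for y
  proof -
    define n where "n = \<lfloor>y - \<rho> 0\<rfloor>"
    have "\<rho> (0 + of_int n) \<le> y" "y \<le> \<rho> (0 + of_int (n + 1))"
      unfolding per_int n_def by linarith+
    moreover have "isCont \<rho> x" for x
      using der DERIV_isCont by blast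
    ultimately show ?thesis
      using IVT[of \<rho> "0 + of_int n" y "0 + of_int (n + 1)"] by auto
  qed
  \<comment> \<open>\<open>\<rho>\<close> may move the base point; taking the fractional part
    returns its values to the fundamental interval.\<close>
  define \<phi> where "\<phi> t = frac (\<rho> t)" for t
  have \<phi>_eq: "\<phi> t = \<rho> t + of_int (- \<lfloor>\<rho> t\<rfloor>)" for t
    by (simp add: \<phi>_def frac_def)
  have \<phi>_range: "\<phi> t \<in> {0..<1}" for t
    by (simp add: \<phi>_def frac_lt_1)
  have curve_\<phi>: "curve D (\<phi> t) = curve D' t" and mark_\<phi>: "mark D (\<phi> t) = mark D (\<rho> t)" for t
    using curve_mark_shift[OF D, of "\<rho> t" "- \<lfloor>\<rho> t\<rfloor>"] curve by (simp_all add: \<phi>_eq)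
  have tangent_\<phi>: "tangent D' t = deriv \<rho> t *\<^sub>R tangent D (\<phi> t)" for t
  proof -
    have "((curve D \<circ> \<rho>) has_vector_derivative deriv \<rho> t *\<^sub>R tangent D (\<rho> t)) (at t)"
      using der has_tangent[OF D]
      by (intro vector_diff_chain_at) (auto simp: has_real_derivative_iff_has_vector_derivative)
    then have "(curve D' has_vector_derivative deriv \<rho> t *\<^sub>R tangent D (\<rho> t)) (at t)"
      unfolding ext[of "curve D'", OF curve] o_def .
    then show ?thesis
      unfolding \<phi>_eq tangent_shift[OF D] using has_tangent[OF D'] vector_derivative_unique_at by blast
  qed
  \<comment> \<open>On the fundamental interval \<open>\<rho>\<close> runs through one period from
    \<open>\<rho> 0\<close>, so it passes at most one further integer. The three cases are that
    neither point, both points, or only the later point \<open>u\<close> lies past that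
    integer.\<close>
  have \<phi>_order: "\<phi> 0 \<le> \<phi> x \<and> \<phi> x < \<phi> u \<or> \<phi> x < \<phi> u \<and> \<phi> u < \<phi> 0 \<or> \<phi> u < \<phi> 0 \<and> \<phi> 0 \<le> \<phi> x"
    if "x \<in> {0..<1}" "u \<in> {0..<1}" "x < u" for x u
  proof -
    define K where "K = \<lfloor>\<rho> 0\<rfloor>"
    have bd: "\<rho> 0 \<le> \<rho> x" "\<rho> x < \<rho> u" "\<rho> u < \<rho> 0 + 1"
      using that mono[of x 0] mono[of x u] mono[of u "0 + 1"] per[of 0] by auto
    have K: "of_int K \<le> \<rho> 0" "\<rho> 0 < of_int K + 1"
      unfolding K_def by linarith+
    have "\<lfloor>\<rho> y\<rfloor> = K \<or> \<lfloor>\<rho> y\<rfloor> = K + 1" if "\<rho> 0 \<le> \<rho> y" "\<rho> y < \<rho> 0 + 1" for y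
      using that unfolding K_def by linarith
    then have eq: "\<phi> y = \<rho> y - of_int K \<or> \<phi> y = \<rho> y - of_int K - 1"
      if "\<rho> 0 \<le> \<rho> y" "\<rho> y < \<rho> 0 + 1" for y
      using that unfolding \<phi>_eq by fastforce
    have "\<phi> x = \<rho> x - of_int K \<or> \<phi> x = \<rho> x - of_int K - 1"
      "\<phi> u = \<rho> u - of_int K \<or> \<phi> u = \<rho> u - of_int K - 1"
      using eq[of x] eq[of u] bd by linarith+
    moreover have "\<phi> 0 = \<rho> 0 - of_int K"
      by (simp add: \<phi>_eq K_def)
    moreover have "0 \<le> \<phi> x" "\<phi> x < 1" "0 \<le> \<phi> u" "\<phi> u < 1"
      using \<phi>_range[of x] \<phi>_range[of u] by auto
    ultimately show ?thesis
      using bd K by argo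
  qed
  have \<phi>_inj: "x = u" if "x \<in> {0..<1}" "u \<in> {0..<1}" "\<phi> x = \<phi> u" for x u
    using \<phi>_order[of x u] \<phi>_order[of u x] that by (cases x u rule: linorder_cases) auto
  have order: "(of_bool (x < u) :: int) =
      of_bool (\<phi> x < \<phi> u) - of_bool (\<phi> x < \<phi> 0) + of_bool (\<phi> u < \<phi> 0)"
    if "x \<in> {0..<1}" "u \<in> {0..<1}" for x u
  proof (cases x u rule: linorder_cases)
    case less
    then show ?thesis using \<phi>_order[of x u] that by auto
  next
    case greater
    then show ?thesis using \<phi>_order[of u x] that by auto
  qed simp
  have \<phi>_surj: "\<exists>x\<in>{0..<1}. \<phi> x = y" if "y \<in> {0..<1}" for y
  proof -
    obtain x where x: "\<rho> x = y" using surj by blast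
    have "\<rho> (frac x) = y + of_int (- \<lfloor>x\<rfloor>)"
      using per_int[of x "- \<lfloor>x\<rfloor>"] x by (simp add: frac_def)
    then have "\<phi> (frac x) = y"
      using that by (simp add: \<phi>_def frac_def) linarith
    then show ?thesis by (intro bexI[of _ "frac x"]) (simp_all add: frac_lt_1)
  qed
  have crossing_\<phi>: "crossing D' s t \<longleftrightarrow> s \<in> {0..<1} \<and> t \<in> {0..<1} \<and> crossing D (\<phi> s) (\<phi> t)" for s t
    using \<phi>_range \<phi>_inj[of s t] curve_\<phi>
    by (auto simp: crossing_def)
  show ?thesis
  proof (rule writhe_polynomial_transport[OF D D', of \<phi> "\<phi> 0"])
    show "bij_betw (map_prod \<phi> \<phi>) (crossings D') (crossings D)"
      unfolding bij_betw_def
    proof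
      show "inj_on (map_prod \<phi> \<phi>) (crossings D')"
        using \<phi>_inj by (auto simp: inj_on_def crossings_def crossing_def)
      show "map_prod \<phi> \<phi> ` crossings D' = crossings D"
      proof (intro equalityI subsetI)
        fix c assume "c \<in> map_prod \<phi> \<phi> ` crossings D'"
        then show "c \<in> crossings D" by (auto simp: crossings_def crossing_\<phi>)
      next
        fix c assume "c \<in> crossings D"
        then obtain s t where c: "c = (s, t)" "crossing D s t" by (auto simp: crossings_def)
        then obtain x y where "x \<in> {0..<1}" "y \<in> {0..<1}" "s = \<phi> x" "t = \<phi> y"
          using \<phi>_surj unfolding crossing_def by metis
        then show "c \<in> map_prod \<phi> \<phi> ` crossings D'"
          using c by (auto simp: crossings_def crossing_\<phi> image_iff intro!: bexI[of _ "(x, y)"])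
      qed
    qed
    show "mark D' s = mark D (\<phi> s)" if "crossing D' s t" for s t
      using mark[OF that] mark_\<phi> by simp
    show "chord_sign D' (s, t) = chord_sign D (\<phi> s, \<phi> t)" if "crossing D' s t" for s t
      unfolding chord_sign_def fst_conv snd_conv tangent_\<phi> det2_scaleR
      using mult_pos_pos[OF pos[of s] pos[of t]]
      by (simp add: zero_less_mult_iff[of "deriv \<rho> s * deriv \<rho> t"] less_asym)
    show "(of_bool (x < u) :: int) =
        of_bool (\<phi> x < \<phi> u) - of_bool (\<phi> x < \<phi> 0) + of_bool (\<phi> u < \<phi> 0)"
      if "crossing D' x y" "crossing D' u v" for x y u v
      using that by (intro order) (auto simp: crossing_def)
  qed
qed

section \<open>Ambient isotopies and the orientation of crossings\<close>

lemma det2_linear_image: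
  fixes L :: "complex \<Rightarrow> complex"
  assumes "linear L"
  shows "det2 (L u) (L v) = det2 (L 1) (L \<i>) * det2 u v"
proof -
  have L: "L z = Re z *\<^sub>R L 1 + Im z *\<^sub>R L \<i>" for z
  proof -
    have "z = Re z *\<^sub>R 1 + Im z *\<^sub>R \<i>" by (simp add: complex_eq_iff)
    then show ?thesis by (metis assms linear_add linear_scale)
  qed
  show ?thesis
    by (subst (1) L, subst (1) L[of v]) (simp add: det2_def algebra_simps)
qed

text \<open>The Jacobian determinant never vanishes, and it equals 1 at the start of the isotopy.\<close>

lemma ambient_isotopy_det_pos:
  assumes H: "ambient_isotopy H"
  obtains L where "\<And>z. (H 1 has_derivative L z) (at z)" "\<And>z. det2 (L z 1) (L z \<i>) > 0"
proof -
  obtain H' where H0: "H 0 = id"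
    and der: "\<And>s z. s \<in> {0..1} \<Longrightarrow> (H s has_derivative H' s z) (at z)"
    and bij: "\<And>s z. s \<in> {0..1} \<Longrightarrow> bij (H' s z)"
    and cont: "\<And>v. continuous_on ({0..1} \<times> UNIV) (\<lambda>(s, z). H' s z v)"
    using H unfolding ambient_isotopy_def by blast
  have "det2 (H' 1 z 1) (H' 1 z \<i>) > 0" for z
  proof (rule ccontr)
    assume neg: "\<not> ?thesis"
    define g where "g s = det2 (H' s z 1) (H' s z \<i>)" for s
    have c: "continuous_on {0..1} (\<lambda>s. H' s z v)" for v
    proof -
      have "continuous_on {0..1} ((\<lambda>(s, z). H' s z v) \<circ> (\<lambda>s. (s, z)))"
        by (intro continuous_on_compose continuous_intros continuous_on_subset[OF cont[of v]]) auto
      then show ?thesis by (simp add: o_def)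
    qed
    have "continuous_on {0..1} g"
      unfolding g_def det2_def by (intro continuous_intros c)
    moreover have "g 0 = 1"
    proof -
      have "(id has_derivative H' 0 z) (at z)" using der[of 0 z] H0 by simp
      moreover have "(id has_derivative id) (at z)" by (rule has_derivative_id)
      ultimately have "H' 0 z = id" by (rule has_derivative_unique)
      then show ?thesis by (simp add: g_def det2_def)
    qed
    ultimately obtain s where s: "s \<in> {0..1}" "g s = 0"
      using IVT2'[of g 1 0 0] neg by (force simp: g_def)
    then have lin: "linear (H' s z)"
      using der has_derivative_linear by blast
    \<comment> \<open>If \<open>g s\<close> vanished, so would the determinant of every pair of
      image vectors; but surjectivity puts \<open>1\<close> and \<open>\<i>\<close>, of determinant
      1, among them.\<close>
    obtain u v where uv: "H' s z u = 1" "H' s z v = \<i>"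
      using bij[OF s(1), of z] by (metis bij_pointE)
    have "det2 (H' s z u) (H' s z v) = 0"
      using s(2) det2_linear_image[OF lin, of u v] by (simp add: g_def)
    then show False by (simp add: uv det2_def)
  qed
  then show ?thesis using that[of "H' 1"] der by auto
qed

lemma writhe_polynomial_isotoped:
  fixes D D' :: "('a :: finite) diagram"
  assumes D: "is_diagram D" and D': "is_diagram D'" and "isotoped D D'"
  shows "writhe_polynomial D = writhe_polynomial D'"
proof -
  obtain H where H: "ambient_isotopy H" and curve: "\<And>t. curve D' t = H 1 (curve D t)"
    and mark: "\<And>s t. crossing D' s t \<Longrightarrow> mark D' s = mark D s"
    using assms(3) unfolding isotoped_def by blast
  obtain L where L: "\<And>z. (H 1 has_derivative L z) (at z)" and det: "\<And>z. det2 (L z 1) (L z \<i>) > 0"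
    using ambient_isotopy_det_pos[OF H] by blast
  have "inj (H 1)"
    using H unfolding ambient_isotopy_def by (auto simp: bij_def)
  then have cr: "crossing D' s t \<longleftrightarrow> crossing D s t" for s t
    by (auto simp: crossing_def curve inj_eq)
  have tangent: "tangent D' t = L (curve D t) (tangent D t)" for t
  proof -
    have lin: "linear (L (curve D t))"
      using L has_derivative_linear by blast
    have "((\<lambda>x. H 1 (curve D x)) has_derivative (\<lambda>h. L (curve D t) (h *\<^sub>R tangent D t))) (at t)"
      using has_derivative_compose[OF _ L] has_tangent[OF D, of t]
      unfolding has_vector_derivative_def by blast
    then have "(curve D' has_vector_derivative L (curve D t) (tangent D t)) (at t)"
      unfolding has_vector_derivative_def linear_scale[OF lin] ext[of "curve D'", OF curve] .
    then show ?thesis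
      using has_tangent[OF D'] vector_derivative_unique_at by blast
  qed
  \<comment> \<open>The parameters do not move, and no crossing has a negative parameter, so cutting
    at \<open>0\<close> leaves the order as it is.\<close>
  show ?thesis
  proof (rule writhe_polynomial_transport[OF D D', of id 0])
    show "bij_betw (map_prod id id) (crossings D') (crossings D)"
      by (simp add: crossings_def cr prod.map_id0 bij_betw_id)
    show "mark D' s = mark D (id s)" if "crossing D' s t" for s t
      using mark[OF that] by simp
    show "chord_sign D' (s, t) = chord_sign D (id s, id t)" if "crossing D' s t" for s t
    proof -
      \<comment> \<open>Both branches pass through the same point, so one derivative acts on both
        tangents, and its positive determinant preserves the sign.\<close>
      have "curve D s = curve D t"
        using that unfolding cr unfolding crossing_def by blast
      then show ?thesis
        unfolding chord_sign_def fst_conv snd_conv tangent id_apply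
        using det2_linear_image[OF has_derivative_linear[OF L[of "curve D t"]], of "tangent D s" "tangent D t"]
          det[of "curve D t"] by (simp add: zero_less_mult_iff less_asym)
    qed
  qed (auto simp: crossing_def)
qed

section \<open>Local moves\<close>

definition crossings_in :: "'a diagram \<Rightarrow> real set \<Rightarrow> (real \<times> real) set" where
  "crossings_in D I = {(s, t). crossing D s t \<and> s \<in> I}"

lemma weight_Union:
  assumes "finite \<J>" "pairwise disjnt \<J>"
  shows "weight D i (\<Union>\<J>) = (\<Sum>J\<in>\<J>. weight D i J)"
  using assms
proof (induction rule: finite_induct)
  case empty
  then show ?case by (simp add: weight_def)
next
  case (insert J \<J>)
  then have "J \<inter> \<Union>\<J> = {}"
    by (auto simp: pairwise_insert disjnt_def)
  with insert show ?case by (simp add: weight_Un pairwise_insert)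
qed

lemma tangent_cong:
  assumes "eventually (\<lambda>x. curve D' x = curve D x) (nhds t)"
  shows "tangent D' t = tangent D t"
  unfolding tangent_def using assms by (intro vector_derivative_cong_eq) auto

lemma tangent_same_away:
  assumes D: "is_diagram D" and D': "is_diagram D'"
    and away: "same_away_from a b D D'" and ab: "0 < a" "a < b" "b < 1"
    and t: "t \<in> {0..<1}" "t \<notin> {a..b}"
  shows "tangent D' t = tangent D t"
proof -
  have same: "curve D' x = curve D x" if "x \<in> {0..1} - {a<..<b}" for x
    using away that unfolding same_away_from_def by blast
  have shift: "curve D' (x + 1) = curve D' x" "curve D (x + 1) = curve D x" for x
    using D D' unfolding is_diagram_def by blast+
  \<comment> \<open>Extending to \<open>b - 1\<close> in the previous period gives the parameter 0
    an open neighbourhood on which the curves agree.\<close>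
  have "curve D' x = curve D x" if "x \<in> {b - 1<..<a} \<union> {b<..<1}" for x
  proof (cases "x \<ge> 0")
    case True
    then show ?thesis using that ab by (intro same) auto
  next
    case False
    then show ?thesis using that ab same[of "x + 1"] shift[of x] by simp
  qed
  moreover have "eventually (\<lambda>x. x \<in> {b - 1<..<a} \<union> {b<..<1}) (nhds t)"
    using t ab by (intro eventually_nhds_in_open open_Un open_greaterThanLessThan) auto
  ultimately show ?thesis
    by (intro tangent_cong) (auto elim: eventually_mono)
qed

text \<open>The common frame of kinks, bigons and triangles. \<open>\<J>\<close> consists of the
  parameter intervals of all strands in the square, also of those that stay fixed. The condition
  that has to be computed for each move is \<open>weight_strand\<close>; the geometry of the square
  supplies the closure and agreement conditions.\<close>

locale local_move =
  fixes D D' :: "('a :: finite) diagram" and \<J> :: "real set set"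
  assumes D: "is_diagram D" and D': "is_diagram D'"
    and finite_strands: "finite \<J>" and disjoint_strands: "pairwise disjnt \<J>"
    and interval_strands: "J \<in> \<J> \<Longrightarrow> is_interval J"
    and closed: "crossing D s t \<Longrightarrow> s \<in> \<Union>\<J> \<Longrightarrow> t \<in> \<Union>\<J>"
    and closed': "crossing D' s t \<Longrightarrow> s \<in> \<Union>\<J> \<Longrightarrow> t \<in> \<Union>\<J>"
    and crossing_away: "s \<notin> \<Union>\<J> \<Longrightarrow> t \<notin> \<Union>\<J> \<Longrightarrow> crossing D' s t \<longleftrightarrow> crossing D s t"
    and mark_away: "s \<notin> \<Union>\<J> \<Longrightarrow> crossing D s t \<Longrightarrow> mark D' s = mark D s"
    and sign_away: "s \<notin> \<Union>\<J> \<Longrightarrow> crossing D s t \<Longrightarrow> chord_sign D' (s, t) = chord_sign D (s, t)"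
    and weight_strand: "J \<in> \<J> \<Longrightarrow> weight D' i J = weight D i J"
begin

definition outer :: "(real \<times> real) set" where
  "outer = crossings D - crossings_in D (\<Union>\<J>)"

lemma outer_iff: "(s, t) \<in> outer \<longleftrightarrow> crossing D s t \<and> s \<notin> \<Union>\<J>"
  by (auto simp: outer_def crossings_def crossings_in_def)

lemma outer_swap: "(s, t) \<in> outer \<longleftrightarrow> (t, s) \<in> outer"
  unfolding outer_iff using closed crossing_sym[of D s t] by blast

lemma outer_eq: "crossings D' - crossings_in D' (\<Union>\<J>) = outer"
proof -
  have "crossing D' s t \<and> s \<notin> \<Union>\<J> \<longleftrightarrow> crossing D s t \<and> s \<notin> \<Union>\<J>" for s t
    using closed[of t s] closed'[of t s] crossing_away[of s t] crossing_sym[of D s t]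
      crossing_sym[of D' s t] by blast
  then show ?thesis
    unfolding outer_def crossings_def crossings_in_def by auto
qed

lemma sum_crossings_split:
  "(\<Sum>c\<in>crossings D. h c) = (\<Sum>c\<in>crossings_in D (\<Union>\<J>). h c) + (\<Sum>c\<in>outer. h c)"
  "(\<Sum>c\<in>crossings D'. h c) = (\<Sum>c\<in>crossings_in D' (\<Union>\<J>). h c) + (\<Sum>c\<in>outer. h c)"
proof -
  have "crossings_in D (\<Union>\<J>) \<subseteq> crossings D" "crossings_in D' (\<Union>\<J>) \<subseteq> crossings D'"
    by (auto simp: crossings_in_def crossings_def)
  then show
    "(\<Sum>c\<in>crossings D. h c) = (\<Sum>c\<in>crossings_in D (\<Union>\<J>). h c) + (\<Sum>c\<in>outer. h c)"
    "(\<Sum>c\<in>crossings D'. h c) = (\<Sum>c\<in>crossings_in D' (\<Union>\<J>). h c) + (\<Sum>c\<in>outer. h c)"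
    using sum.subset_diff finite_crossings[OF D] finite_crossings[OF D'] outer_eq outer_def
    by (metis add.commute)+
qed

lemma weight_away:
  assumes "T \<inter> \<Union>\<J> = {}"
  shows "weight D' i T = weight D i T"
proof -
  have "(\<Sum>(s, t)\<in>crossings_in D'' (\<Union>\<J>).
      if mark D'' s = Virtual i \<and> t \<in> T then chord_sign D'' (s, t) else 0) = 0"
    if D'': "D'' = D \<or> D'' = D'" for D''
  proof (intro sum.neutral, clarify)
    fix s t assume "(s, t) \<in> crossings_in D'' (\<Union>\<J>)"
    then have "crossing D'' s t" "s \<in> \<Union>\<J>"
      by (auto simp: crossings_in_def)
    then have "t \<notin> T"
      using D'' closed closed' assms by blast
    then show "(if mark D'' s = Virtual i \<and> t \<in> T then chord_sign D'' (s, t) else 0) = 0"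
      by simp
  qed
  moreover have "(\<Sum>(s, t)\<in>outer. if mark D s = Virtual i \<and> t \<in> T then chord_sign D (s, t) else 0) =
      (\<Sum>(s, t)\<in>outer. if mark D' s = Virtual i \<and> t \<in> T then chord_sign D' (s, t) else 0)"
    by (intro sum.cong) (auto simp: outer_iff mark_away sign_away)
  ultimately show ?thesis
    unfolding weight_def sum_crossings_split by simp
qed

text \<open>A set that contains each strand it meets splits into a part away from the strands and a
  union of whole strands, and each of these keeps its weight.\<close>

lemma weight_saturated:
  assumes "\<And>J. J \<in> \<J> \<Longrightarrow> J \<inter> T \<noteq> {} \<Longrightarrow> J \<subseteq> T"
  shows "weight D' i T = weight D i T"
proof -
  define \<K> where "\<K> = {J \<in> \<J>. J \<inter> T \<noteq> {}}"
  have T: "T = (T - \<Union>\<J>) \<union> \<Union>\<K>"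
    using assms by (auto simp: \<K>_def)
  have \<K>: "finite \<K>" "pairwise disjnt \<K>"
    using finite_strands disjoint_strands by (auto simp: \<K>_def intro: pairwise_subset)
  have "weight D'' i T = weight D'' i (T - \<Union>\<J>) + (\<Sum>J\<in>\<K>. weight D'' i J)" for D'' :: "'a diagram"
  proof -
    have "weight D'' i ((T - \<Union>\<J>) \<union> \<Union>\<K>) = weight D'' i (T - \<Union>\<J>) + weight D'' i (\<Union>\<K>)"
      by (rule weight_Un) (auto simp: \<K>_def)
    then show ?thesis
      unfolding T[symmetric] weight_Union[OF \<K>] .
  qed
  moreover have "weight D' i (T - \<Union>\<J>) = weight D i (T - \<Union>\<J>)"
    by (intro weight_away) auto
  moreover have "(\<Sum>J\<in>\<K>. weight D' i J) = (\<Sum>J\<in>\<K>. weight D i J)"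
    by (intro sum.cong refl weight_strand) (auto simp: \<K>_def)
  ultimately show ?thesis by simp
qed

lemma interval_strandsD: "J \<in> \<J> \<Longrightarrow> x \<in> J \<Longrightarrow> y \<in> J \<Longrightarrow> x \<le> z \<Longrightarrow> z \<le> y \<Longrightarrow> z \<in> J"
  using interval_strands unfolding is_interval_1 by blast

text \<open>A strand is an interval avoiding \<open>s\<close>, so it lies entirely on one side of
  \<open>s\<close>.\<close>

lemma weight_lessThan_outer:
  assumes "s \<notin> \<Union>\<J>"
  shows "weight D' i {..<s} = weight D i {..<s}"
proof (rule weight_saturated)
  fix J assume J: "J \<in> \<J>" "J \<inter> {..<s} \<noteq> {}"
  show "J \<subseteq> {..<s}"
  proof
    fix x assume "x \<in> J"
    then show "x \<in> {..<s}"
      using J assms interval_strandsD[OF J(1), of _ x s] by (force simp: not_less)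
  qed
qed

text \<open>The potential just after the strand. The set contains \<open>J\<close> as a whole, so
  both diagrams share this value, and potentials inside \<open>J\<close> are measured backwards from
  it.\<close>

definition strand_weight :: "'a \<Rightarrow> real set \<Rightarrow> int" where
  "strand_weight i J = weight D i {x. \<exists>y\<in>J. x \<le> y}"

lemma strand_weight':
  assumes J: "J \<in> \<J>"
  shows "weight D' i {x. \<exists>y\<in>J. x \<le> y} = strand_weight i J"
  unfolding strand_weight_def
proof (rule weight_saturated)
  fix J' assume J': "J' \<in> \<J>" "J' \<inter> {x. \<exists>y\<in>J. x \<le> y} \<noteq> {}"
  show "J' \<subseteq> {x. \<exists>y\<in>J. x \<le> y}"
  proof (cases "J' = J")
    case False
    then have disj: "J' \<inter> J = {}"
      using J J' disjoint_strands by (auto simp: pairwise_def disjnt_def)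
    show ?thesis
    proof
      fix x assume "x \<in> J'"
      then show "x \<in> {x. \<exists>y\<in>J. x \<le> y}"
        using J'(2) interval_strandsD[OF J'(1), of _ x] disj by (force simp: not_le)
    qed
  qed auto
qed

lemma weight_lessThan_strand:
  assumes J: "J \<in> \<J>" and p: "p \<in> J"
  shows "weight D i {..<p} = strand_weight i J - weight D i (J \<inter> {p..})"
    and "weight D' i {..<p} = strand_weight i J - weight D' i (J \<inter> {p..})"
proof -
  have eq: "{x. \<exists>y\<in>J. x \<le> y} = {..<p} \<union> (J \<inter> {p..})"
  proof (rule set_eqI)
    fix x
    show "x \<in> {x. \<exists>y\<in>J. x \<le> y} \<longleftrightarrow> x \<in> {..<p} \<union> (J \<inter> {p..})"
      using p interval_strandsD[OF J, of p _ x] by (cases "x < p") (auto intro: less_imp_le)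
  qed
  have "weight D'' i {x. \<exists>y\<in>J. x \<le> y} = weight D'' i {..<p} + weight D'' i (J \<inter> {p..})"
    for D'' :: "'a diagram"
    unfolding eq by (rule weight_Un) auto
  then show "weight D i {..<p} = strand_weight i J - weight D i (J \<inter> {p..})"
    "weight D' i {..<p} = strand_weight i J - weight D' i (J \<inter> {p..})"
    using strand_weight'[OF J, of i] by (simp_all add: strand_weight_def)
qed

lemma writhe_polynomial_local:
  assumes "(\<Sum>(s, t)\<in>crossings_in D (\<Union>\<J>). crossing_term D s t) =
    (\<Sum>(s, t)\<in>crossings_in D' (\<Union>\<J>). crossing_term D' s t)"
  shows "writhe_polynomial D = writhe_polynomial D'"
proof -
  have "crossing_term D s t = crossing_term D' s t" if st: "(s, t) \<in> outer" for s t
  proof -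
    have "(t, s) \<in> outer" using st outer_swap by blast
    then show ?thesis
      using st by (simp add: crossing_term_def outer_iff mark_away[of s t] mark_away[of t s]
          sign_away weight_lessThan_outer)
  qed
  then have "(\<Sum>(s, t)\<in>outer. crossing_term D s t) = (\<Sum>(s, t)\<in>outer. crossing_term D' s t)"
    by (intro sum.cong) auto
  then show ?thesis
    unfolding writhe_polynomial_eq[OF D] writhe_polynomial_eq[OF D'] sum_crossings_split
    using assms by simp
qed

end

section \<open>Crossings inside the square of a move\<close>

lemma crossing_in_square:
  assumes "meets_square_in D I" "crossing D s t" "s \<in> I"
  shows "t \<in> I"
proof -
  have st: "s \<in> {0..1}" "t \<in> {0..1}" "curve D s = curve D t"
    using assms(2) unfolding crossing_def by auto
  then have "curve D s \<in> square"
    using assms(1,3) unfolding meets_square_in_def by blast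
  then show ?thesis
    using assms(1) st unfolding meets_square_in_def by metis
qed

lemma local_moveI:
  fixes D D' :: "('a :: finite) diagram"
  assumes D: "is_diagram D" and D': "is_diagram D'"
    and away: "same_away_from a b D D'" and ab: "0 < a" "a < b" "b < 1" "{a..b} \<in> \<J>"
    and strands: "finite \<J>" "pairwise disjnt \<J>" "\<And>J. J \<in> \<J> \<Longrightarrow> is_interval J"
    and square: "meets_square_in D (\<Union>\<J>)" "meets_square_in D' (\<Union>\<J>)"
    and weights: "\<And>i J. J \<in> \<J> \<Longrightarrow> weight D' i J = weight D i J"
  shows "local_move D D' \<J>"
proof
  have sub: "x \<notin> {a..b}" if "x \<notin> \<Union>\<J>" for x
    using that ab by blast
  have outer: "t \<notin> \<Union>\<J>" if "s \<notin> \<Union>\<J>" "crossing D s t" for s t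
    using that crossing_in_square[OF square(1), of t s] crossing_sym[of D s t] by blast
  show "crossing D' s t \<longleftrightarrow> crossing D s t" if "s \<notin> \<Union>\<J>" "t \<notin> \<Union>\<J>" for s t
  proof -
    have "curve D' x = curve D x" if "x \<in> {0..<1}" "x \<notin> \<Union>\<J>" for x
      using away that sub[of x] unfolding same_away_from_def by auto
    then show ?thesis using that by (auto simp: crossing_def)
  qed
  show "mark D' s = mark D s" if "s \<notin> \<Union>\<J>" "crossing D s t" for s t
    using away that sub outer[OF that] unfolding same_away_from_def by blast
  show "chord_sign D' (s, t) = chord_sign D (s, t)" if "s \<notin> \<Union>\<J>" "crossing D s t" for s t
  proof -
    have "tangent D' s = tangent D s" "tangent D' t = tangent D t"
      using that outer[OF that] sub tangent_same_away[OF D D' away ab(1-3)]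
      unfolding crossing_def by blast+
    then show ?thesis by (simp add: chord_sign_def)
  qed
qed (use D D' strands weights crossing_in_square square in blast)+

text \<open>\<open>N\<close> chooses one order for each crossing, and thereby the signs that are
  compared before and after a move; the converse restores the other order.\<close>

definition sym_pairs :: "(real \<times> real) set \<Rightarrow> (real \<times> real) set" where
  "sym_pairs N = N \<union> N\<inverse>"

lemma sum_sym_pairs:
  assumes "finite N" "N \<inter> N\<inverse> = {}"
  shows "(\<Sum>(s, t)\<in>sym_pairs N. h s t) = (\<Sum>(s, t)\<in>N. h s t + h t s)"
proof -
  have "N\<inverse> = prod.swap ` N" by force
  then have "(\<Sum>(s, t)\<in>N\<inverse>. h s t) = (\<Sum>(s, t)\<in>N. h t s)"
    by (simp add: sum.reindex case_prod_unfold)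
  then show ?thesis
    unfolding sym_pairs_def using assms
    by (subst sum.union_disjoint) (auto simp: sum.distrib case_prod_unfold)
qed

text \<open>The square contains both preimages of a crossing or neither, so only the pairs from
  \<open>N\<close> matter. The two components of such a pair carry opposite weights, whence the
  difference of indicators.\<close>

lemma weight_inside:
  assumes D: "is_diagram D" and sq: "meets_square_in D I" and "T \<subseteq> I"
    and N: "crossings_in D I = sym_pairs N" "finite N" "N \<inter> N\<inverse> = {}"
  shows "weight D i T =
    (\<Sum>(s, t)\<in>N. if mark D s = Virtual i then chord_sign D (s, t) * (of_bool (t \<in> T) - of_bool (s \<in> T)) else 0)"
proof -
  let ?h = "\<lambda>s t. if mark D s = Virtual i \<and> t \<in> T then chord_sign D (s, t) else 0"
  have "weight D i T = (\<Sum>(s, t)\<in>crossings_in D I. ?h s t)"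
    unfolding weight_def
  proof (rule sum.mono_neutral_right[OF finite_crossings[OF D]])
    show "crossings_in D I \<subseteq> crossings D"
      by (auto simp: crossings_def crossings_in_def)
    show "\<forall>c\<in>crossings D - crossings_in D I. (case c of (s, t) \<Rightarrow> ?h s t) = 0"
    proof clarify
      fix s t assume "(s, t) \<in> crossings D" "(s, t) \<notin> crossings_in D I"
      then have "t \<notin> T"
        using crossing_in_square[OF sq, of t s] crossing_sym[of D s t] \<open>T \<subseteq> I\<close>
        by (auto simp: crossings_def crossings_in_def)
      then show "?h s t = 0" by simp
    qed
  qed
  also have "\<dots> = (\<Sum>(s, t)\<in>N. ?h s t + ?h t s)"
    unfolding N(1) by (rule sum_sym_pairs[OF N(2,3)])
  also have "\<dots> = (\<Sum>(s, t)\<in>N. if mark D s = Virtual i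
      then chord_sign D (s, t) * (of_bool (t \<in> T) - of_bool (s \<in> T)) else 0)"
  proof (intro sum.cong refl, clarify)
    fix s t assume "(s, t) \<in> N"
    then have c: "crossing D s t"
      using N(1) by (auto simp: crossings_in_def sym_pairs_def)
    have "mark D t = Virtual i \<longleftrightarrow> mark D s = Virtual i"
      using crossing_mark[OF D c] by (cases "mark D s") auto
    then show "?h s t + ?h t s = (if mark D s = Virtual i
      then chord_sign D (s, t) * (of_bool (t \<in> T) - of_bool (s \<in> T)) else 0)"
      by (simp add: chord_sign_swap[OF D c])
  qed
  finally show ?thesis .
qed

text \<open>At most one summand is nonzero: the first if \<open>m\<close> is \<open>Over\<close>,
  the second if it is \<open>Under\<close>. Reversing the pair negates both its sign and its
  difference of potentials.\<close>

definition both_terms :: "('a :: finite) mark \<Rightarrow> int \<Rightarrow> ('a \<Rightarrow> int) \<Rightarrow> 'a laurent" where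
  "both_terms m e d = marked_term m (partner_mark m) e d + marked_term (partner_mark m) m (- e) (\<lambda>i. - d i)"

lemma both_terms_eq:
  assumes D: "is_diagram D" and c: "crossing D s t"
  shows "crossing_term D s t + crossing_term D t s =
    both_terms (mark D s) (chord_sign D (s, t)) (\<lambda>i. weight D i {..<s} - weight D i {..<t})"
  unfolding crossing_term_def both_terms_def
  by (simp add: crossing_mark[OF D c] chord_sign_swap[OF D c])

lemma both_terms_Virtual [simp]: "both_terms (Virtual i) e d = 0"
  by (simp add: both_terms_def marked_term_def)

lemma both_terms_0 [simp]: "both_terms m e (\<lambda>_. 0) = 0"
  by (simp add: both_terms_def marked_term_def monomial_0)

lemma both_terms_cancel: "both_terms m e d + both_terms m (- e) d = 0"
  by (simp add: both_terms_def marked_term_def)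

section \<open>Strands that are graphs\<close>

text \<open>
  The strand is parametrized by the abscissa: \<open>p x\<close> is the parameter of its point over \<open>x\<close>, and
  \<open>\<sigma> = \<plusminus>1\<close> says whether the strand runs to the right or to the left.
\<close>

definition graph_strand ::
  "'a diagram \<Rightarrow> real \<Rightarrow> real \<Rightarrow> (real \<Rightarrow> real) \<Rightarrow> (real \<Rightarrow> real) \<Rightarrow> real \<Rightarrow> bool" where
  "graph_strand D a b f p \<sigma> \<longleftrightarrow>
     \<sigma> \<in> {-1, 1} \<and> 0 < a \<and> a < b \<and> b < 1 \<and> p ` {-1..1} = {a..b} \<and> p (- \<sigma>) = a \<and> p \<sigma> = b \<and>
     (\<forall>x\<in>{-1..1}. curve D (p x) = Complex x (f x) \<and>
        (\<exists>r>0. tangent D (p x) = (\<sigma> * r) *\<^sub>R Complex 1 (deriv f x))) \<and>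
     (\<forall>x\<in>{-1..1}. \<forall>y\<in>{-1..1}. p x < p y \<longleftrightarrow> \<sigma> * x < \<sigma> * y)"

text \<open>At an endpoint only one side of \<open>t\<close> is available, but a negative derivative
  contradicts monotonicity already on one side.\<close>

lemma deriv_nonneg_of_mono_on:
  fixes g :: "real \<Rightarrow> real"
  assumes der: "(g has_real_derivative d) (at t)" and t: "t \<in> {a..b}" "a < b"
    and mono: "\<And>x y. x \<in> {a..b} \<Longrightarrow> y \<in> {a..b} \<Longrightarrow> x < y \<Longrightarrow> g x < g y"
  shows "d \<ge> 0"
proof (rule ccontr)
  assume "\<not> d \<ge> 0"
  then have neg: "d < 0" by simp
  show False
  proof (cases "t < b")
    case True
    obtain e where e: "e > 0" "\<And>h. h > 0 \<Longrightarrow> h < e \<Longrightarrow> g t > g (t + h)"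
      using DERIV_neg_dec_right[OF der neg] by blast
    define h where "h = min (e / 2) (b - t)"
    have "h > 0" "h < e" "t + h \<in> {a..b}"
      using e(1) True t by (auto simp: h_def min_def)
    then show False
      using e(2)[of h] mono[of t "t + h"] t by force
  next
    case False
    obtain e where e: "e > 0" "\<And>h. h > 0 \<Longrightarrow> h < e \<Longrightarrow> g t < g (t - h)"
      using DERIV_neg_dec_left[OF der neg] by blast
    define h where "h = min (e / 2) (t - a)"
    have "h > 0" "h < e" "t - h \<in> {a..b}"
      using e(1) False t by (auto simp: h_def min_def)
    then show False
      using e(2)[of h] mono[of "t - h" t] t by force
  qed
qed

lemma C1_real_derivative:
  fixes f :: "real \<Rightarrow> real"
  assumes "f C1_differentiable_on S" "x \<in> S"
  shows "(f has_real_derivative deriv f x) (at x)"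
  using assms by (simp add: C1_differentiable_on_eq DERIV_deriv_iff_real_differentiable)

lemma tangent_components:
  assumes "is_diagram D"
  shows "((\<lambda>t. Re (curve D t)) has_real_derivative Re (tangent D t)) (at t)"
    and "((\<lambda>t. Im (curve D t)) has_real_derivative Im (tangent D t)) (at t)"
  using has_tangent[OF assms, of t]
  by (auto simp: has_real_derivative_iff_has_vector_derivative intro: bounded_linear.has_vector_derivative
      bounded_linear_Re bounded_linear_Im)

text \<open>The abscissa \<open>X\<close> is a continuous bijection between intervals, hence
  monotone; \<open>\<sigma>\<close> is its direction and \<open>p\<close> its inverse.
  Differentiating \<open>Im (curve D s) = f (X s)\<close> makes the tangent a multiple of
  \<open>Complex 1 (deriv f x)\<close>, and the multiple is nonzero because the curve is an
  immersion.\<close>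

lemma strand_graph:
  assumes D: "is_diagram D" and strand: "strand D a b (graph_over f)"
    and f: "f C1_differentiable_on {-1..1}"
  obtains p \<sigma> where "graph_strand D a b f p \<sigma>"
proof -
  have ab: "0 < a" "a < b" "b < 1" and bij: "bij_betw (curve D) {a..b} (graph_over f)"
    using strand by (auto simp: strand_def)
  define X where "X t = Re (curve D t)" for t
  have "bij_betw Re (graph_over f) {-1..1}"
    by (rule bij_betwI[where g = "\<lambda>x. Complex x (f x)"]) (auto simp: graph_over_def)
  from bij_betw_trans[OF bij this] have bijX: "bij_betw X {a..b} {-1..1}"
    unfolding o_def X_def[symmetric] .
  have curve: "curve D t = Complex (X t) (f (X t))" if "t \<in> {a..b}" for t
  proof -
    obtain x where "curve D t = Complex x (f x)"
      using bij_betwE[OF bij] \<open>t \<in> {a..b}\<close> unfolding graph_over_def by blast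
    then show ?thesis by (simp add: X_def)
  qed
  have "continuous_on {a..b} X"
    unfolding X_def using tangent_components(1)[OF D]
    by (intro continuous_at_imp_continuous_on ballI DERIV_isCont) auto
  then have "strict_mono_on {a..b} X \<or> strict_antimono_on {a..b} X"
    using injective_eq_monotone_map[of "{a..b}" X] bijX by (auto simp: bij_betw_def is_interval_cc)
  then obtain \<sigma> :: real where \<sigma>: "\<sigma> \<in> {-1, 1}"
    and mono: "\<And>s t. s \<in> {a..b} \<Longrightarrow> t \<in> {a..b} \<Longrightarrow> s < t \<Longrightarrow> \<sigma> * X s < \<sigma> * X t"
  proof
    assume "strict_mono_on {a..b} X"
    then show ?thesis using that[of 1] by (auto simp: monotone_on_def)
  next
    assume "strict_antimono_on {a..b} X"
    then show ?thesis using that[of "- 1"] by (auto simp: monotone_on_def)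
  qed
  define p where "p = inv_into {a..b} X"
  have p_in: "p x \<in> {a..b}" if "x \<in> {-1..1}" for x
    using bij_betwE[OF bij_betw_inv_into[OF bijX]] that unfolding p_def by blast
  have X_p: "X (p x) = x" if "x \<in> {-1..1}" for x
    unfolding p_def using bij_betw_inv_into_right[OF bijX that] .
  have p_X: "p (X t) = t" if "t \<in> {a..b}" for t
    unfolding p_def using bij_betw_inv_into_left[OF bijX that] .
  have X_in: "X t \<in> {-1..1}" if "t \<in> {a..b}" for t
    using that bijX bij_betwE by blast
  have order: "p x < p y \<longleftrightarrow> \<sigma> * x < \<sigma> * y" if xy: "x \<in> {-1..1}" "y \<in> {-1..1}" for x y
  proof (cases "p x" "p y" rule: linorder_cases)
    case less
    then show ?thesis using mono[OF p_in p_in less] xy X_p by simp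
  next
    case equal
    then have "x = y" using X_p xy by metis
    then show ?thesis by simp
  next
    case greater
    then show ?thesis using mono[OF p_in p_in greater] xy X_p by simp
  qed
  have pa: "p (- \<sigma>) = a"
  proof (rule ccontr)
    assume "p (- \<sigma>) \<noteq> a"
    moreover have "- \<sigma> \<in> {-1..1}" "a \<in> {a..b}" using \<sigma> ab by auto
    ultimately have "\<sigma> * X a < \<sigma> * (- \<sigma>)"
      using mono[of a "p (- \<sigma>)"] p_in[of "- \<sigma>"] X_p[of "- \<sigma>"] by auto
    then show False using \<sigma> X_in[of a] ab by auto
  qed
  have pb: "p \<sigma> = b"
  proof (rule ccontr)
    assume "p \<sigma> \<noteq> b"
    moreover have "\<sigma> \<in> {-1..1}" "b \<in> {a..b}" using \<sigma> ab by auto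
    ultimately have "\<sigma> * \<sigma> < \<sigma> * X b"
      using mono[of "p \<sigma>" b] p_in[of \<sigma>] X_p[of \<sigma>] by auto
    then show False using \<sigma> X_in[of b] ab by auto
  qed
  have tangent: "\<exists>r>0. tangent D (p x) = (\<sigma> * r) *\<^sub>R Complex 1 (deriv f x)" if x: "x \<in> {-1..1}" for x
  proof -
    define t where "t = p x"
    define T where "T = tangent D t"
    have t: "t \<in> {a..b}" "X t = x"
      using x p_in X_p by (auto simp: t_def)
    have derX: "(X has_real_derivative Re T) (at t)"
      unfolding X_def T_def by (rule tangent_components[OF D])
    have "((\<lambda>s. f (X s)) has_real_derivative deriv f x * Re T) (at t)"
      using DERIV_chain2[OF _ derX, of f "deriv f x"] C1_real_derivative[OF f x] t by simp
    \<comment> \<open>Beyond an endpoint of the strand the curve may leave the graph, so the two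
      derivatives are compared within \<open>{a..b}\<close> only.\<close>
    then have "((\<lambda>s. f (X s)) has_real_derivative deriv f x * Re T) (at t within {a..b})"
      by (rule has_field_derivative_at_within)
    moreover have "((\<lambda>s. f (X s)) has_real_derivative Im T) (at t within {a..b})"
    proof (rule has_field_derivative_transform_within[OF _ zero_less_one t(1)])
      show "((\<lambda>s. Im (curve D s)) has_real_derivative Im T) (at t within {a..b})"
        unfolding T_def by (rule has_field_derivative_at_within[OF tangent_components(2)[OF D]])
    next
      show "Im (curve D s) = f (X s)" if "s \<in> {a..b}" for s
        using curve[OF that] by simp
    qed
    ultimately have Im: "deriv f x * Re T = Im T"
      unfolding has_real_derivative_iff_has_vector_derivative
      using vector_derivative_unique_within_closed_interval[OF ab(2), of t] t(1)
      unfolding cbox_interval by blast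
    have "T \<noteq> 0"
      using D by (simp add: T_def is_diagram_def)
    with Im have "Re T \<noteq> 0"
      by (auto simp: complex_eq_iff)
    moreover have "((\<lambda>s. \<sigma> * X s) has_real_derivative \<sigma> * Re T) (at t)"
      using derX by (rule DERIV_cmult)
    then have "\<sigma> * Re T \<ge> 0"
      using mono by (intro deriv_nonneg_of_mono_on[OF _ t(1) ab(2)])
    ultimately have "\<sigma> * Re T > 0"
      using \<sigma> by auto
    moreover have "T = (\<sigma> * (\<sigma> * Re T)) *\<^sub>R Complex 1 (deriv f x)"
      using \<sigma> Im by (auto simp: complex_eq_iff mult.commute)
    ultimately show ?thesis
      unfolding T_def t_def by blast
  qed
  have "p ` {-1..1} = {a..b}"
  proof (intro equalityI subsetI)
    fix t assume "t \<in> {a..b}"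
    then show "t \<in> p ` {-1..1}" using p_X X_in by (metis image_eqI)
  qed (use p_in in blast)
  then have "graph_strand D a b f p \<sigma>"
    unfolding graph_strand_def using \<sigma> ab pa pb curve p_in X_p tangent order by auto
  then show thesis by (rule that)
qed

lemma graph_strand_cong:
  assumes "graph_strand D a b f p \<sigma>"
    and "\<And>t. t \<in> {a..b} \<Longrightarrow> curve D' t = curve D t" "\<And>t. t \<in> {a..b} \<Longrightarrow> tangent D' t = tangent D t"
  shows "graph_strand D' a b f p \<sigma>"
proof -
  have "p x \<in> {a..b}" if "x \<in> {-1..1}" for x
    using assms(1) that unfolding graph_strand_def by blast
  then show ?thesis
    using assms unfolding graph_strand_def by simp
qed

lemma graph_strand_corner:
  assumes "graph_strand D a b f p \<sigma>"
  shows "curve D a = Complex (- \<sigma>) (f (- \<sigma>))" "curve D b = Complex \<sigma> (f \<sigma>)"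
proof -
  have "\<sigma> \<in> {-1..1}" "- \<sigma> \<in> {-1..1}"
    using assms unfolding graph_strand_def by auto
  then show "curve D a = Complex (- \<sigma>) (f (- \<sigma>))" "curve D b = Complex \<sigma> (f \<sigma>)"
    using assms unfolding graph_strand_def by blast+
qed

text \<open>A strand starts at the abscissa \<open>- \<sigma>\<close>, so replacing it between fixed
  ends cannot reverse its direction.\<close>

lemma graph_strand_ends:
  assumes p: "graph_strand D a b f p \<sigma>" and q: "graph_strand D' a b g q \<tau>"
    and "curve D' a = curve D a" "curve D' b = curve D b"
  shows "\<tau> = \<sigma>" "g (- 1) = f (- 1)" "g 1 = f 1"
proof -
  have "Complex (- \<sigma>) (f (- \<sigma>)) = Complex (- \<tau>) (g (- \<tau>))" "Complex \<sigma> (f \<sigma>) = Complex \<tau> (g \<tau>)"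
    using graph_strand_corner[OF p] graph_strand_corner[OF q] assms(3,4) by metis+
  moreover have "\<sigma> \<in> {-1, 1}"
    using p unfolding graph_strand_def by blast
  ultimately show "\<tau> = \<sigma>" "g (- 1) = f (- 1)" "g 1 = f 1"
    by auto
qed

lemma graph_strandD:
  assumes "graph_strand D a b f p \<sigma>"
  shows "\<sigma> = 1 \<or> \<sigma> = - 1" "0 < a" "a < b" "b < 1"
    and "x \<in> {-1..1} \<Longrightarrow> p x \<in> {a..b}"
    and "x \<in> {-1..1} \<Longrightarrow> curve D (p x) = Complex x (f x)"
    and "t \<in> {a..b} \<Longrightarrow> \<exists>x\<in>{-1..1}. t = p x"
    and "x \<in> {-1..1} \<Longrightarrow> y \<in> {-1..1} \<Longrightarrow> p x < p y \<longleftrightarrow> \<sigma> * x < \<sigma> * y"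
proof -
  have range: "p ` {-1..1} = {a..b}"
    and curve: "\<forall>x\<in>{-1..1}. curve D (p x) = Complex x (f x) \<and>
        (\<exists>r>0. tangent D (p x) = (\<sigma> * r) *\<^sub>R Complex 1 (deriv f x))"
    and order: "\<forall>x\<in>{-1..1}. \<forall>y\<in>{-1..1}. p x < p y \<longleftrightarrow> \<sigma> * x < \<sigma> * y"
    and "\<sigma> \<in> {-1, 1}" "0 < a" "a < b" "b < 1"
    by (insert assms, unfold graph_strand_def, (elim conjE, assumption)+)
  then show "\<sigma> = 1 \<or> \<sigma> = - 1" "0 < a" "a < b" "b < 1"
    by blast+
  show "x \<in> {-1..1} \<Longrightarrow> p x \<in> {a..b}" "t \<in> {a..b} \<Longrightarrow> \<exists>x\<in>{-1..1}. t = p x"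
    using range by blast+
  show "x \<in> {-1..1} \<Longrightarrow> curve D (p x) = Complex x (f x)"
    using curve by blast
  show "x \<in> {-1..1} \<Longrightarrow> y \<in> {-1..1} \<Longrightarrow> p x < p y \<longleftrightarrow> \<sigma> * x < \<sigma> * y"
    using order by blast
qed

section \<open>Crossings between two graph strands\<close>

definition meetings :: "(real \<Rightarrow> real) \<Rightarrow> (real \<Rightarrow> real) \<Rightarrow> real set" where
  "meetings f g = {x \<in> {-1..1}. f x = g x}"

lemma crossing_strands:
  assumes p: "graph_strand D a b f p \<sigma>" and q: "graph_strand D c d g q \<tau>"
    and disj: "{a..b} \<inter> {c..d} = {}" and st: "s \<in> {a..b}" "t \<in> {c..d}"
  shows "crossing D s t \<longleftrightarrow> (s, t) \<in> (\<lambda>x. (p x, q x)) ` meetings f g"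
proof -
  obtain x y where x: "x \<in> {-1..1}" "s = p x" and y: "y \<in> {-1..1}" "t = q y"
    using graph_strandD(7)[OF p st(1)] graph_strandD(7)[OF q st(2)] by blast
  have inj: "r = x" if "r \<in> {-1..1}" "p x = p r" for r
    using graph_strandD(6)[OF p that(1)] graph_strandD(6)[OF p x(1)] that by simp
  have inj': "r = y" if "r \<in> {-1..1}" "q y = q r" for r
    using graph_strandD(6)[OF q that(1)] graph_strandD(6)[OF q y(1)] that by simp
  have "s \<noteq> t" "s \<in> {0..<1}" "t \<in> {0..<1}"
    using st disj graph_strandD(2,4)[OF p] graph_strandD(2,4)[OF q] by auto
  then have "crossing D s t \<longleftrightarrow> x = y \<and> f x = g x"
    using x y graph_strandD(6)[OF p x(1)] graph_strandD(6)[OF q y(1)] by (auto simp: crossing_def)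
  also have "\<dots> \<longleftrightarrow> (s, t) \<in> (\<lambda>x. (p x, q x)) ` meetings f g"
    using x y inj inj' by (auto simp: meetings_def)
  finally show ?thesis .
qed

lemma no_self_crossing:
  assumes p: "graph_strand D a b f p \<sigma>" and st: "s \<in> {a..b}" "t \<in> {a..b}"
  shows "\<not> crossing D s t"
proof -
  obtain x y where x: "x \<in> {-1..1}" "s = p x" and y: "y \<in> {-1..1}" "t = p y"
    using graph_strandD(7)[OF p st(1)] graph_strandD(7)[OF p st(2)] by blast
  then show ?thesis
    using graph_strandD(6)[OF p x(1)] graph_strandD(6)[OF p y(1)] by (auto simp: crossing_def)
qed

text \<open>The difference of slopes is the determinant of the two graph directions; the signs
  \<open>\<sigma>\<close> and \<open>\<tau>\<close> orient them, and the speeds only contribute the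
  positive factor \<open>r\<close>.\<close>

lemma strands_tangents:
  assumes p: "graph_strand D a b f p \<sigma>" and q: "graph_strand D c d g q \<tau>" and x: "x \<in> {-1..1}"
  obtains r where "r > 0" "det2 (tangent D (p x)) (tangent D (q x)) = r * (\<sigma> * \<tau> * (deriv g x - deriv f x))"
proof -
  obtain r where r: "r > 0" "tangent D (p x) = (\<sigma> * r) *\<^sub>R Complex 1 (deriv f x)"
    using p x unfolding graph_strand_def by blast
  obtain r' where r': "r' > 0" "tangent D (q x) = (\<tau> * r') *\<^sub>R Complex 1 (deriv g x)"
    using q x unfolding graph_strand_def by blast
  have "det2 (tangent D (p x)) (tangent D (q x)) = (r * r') * (\<sigma> * \<tau> * (deriv g x - deriv f x))"
    unfolding r(2) r'(2) det2_scaleR by (simp add: det2_def algebra_simps)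
  then show thesis
    using that[of "r * r'"] r(1) r'(1) by simp
qed

lemma chord_sign_strands:
  assumes p: "graph_strand D a b f p \<sigma>" and q: "graph_strand D c d g q \<tau>" and x: "x \<in> {-1..1}"
  shows "chord_sign D (p x, q x) = (if \<sigma> * \<tau> * (deriv g x - deriv f x) > 0 then 1 else - 1)"
proof -
  obtain r where r: "r > 0" and
    det: "det2 (tangent D (p x)) (tangent D (q x)) = r * (\<sigma> * \<tau> * (deriv g x - deriv f x))"
    using strands_tangents[OF assms] by blast
  have "r * y > 0 \<longleftrightarrow> y > 0" for y
    using r by (simp add: zero_less_mult_iff)
  then show ?thesis
    unfolding chord_sign_def fst_conv snd_conv det by simp
qed

lemma strands_transverse:
  assumes D: "is_diagram D" and p: "graph_strand D a b f p \<sigma>" and q: "graph_strand D c d g q \<tau>"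
    and "crossing D (p x) (q x)" and x: "x \<in> {-1..1}"
  shows "deriv g x \<noteq> deriv f x"
proof -
  obtain r where "det2 (tangent D (p x)) (tangent D (q x)) = r * (\<sigma> * \<tau> * (deriv g x - deriv f x))"
    using strands_tangents[OF p q x] by blast
  then show ?thesis
    using crossing_det[OF D assms(4)] by auto
qed

lemma graph_over_line: "{z \<in> square. Im z = \<kappa> * Re z} = graph_over (\<lambda>x. \<kappa> * x)" if "\<bar>\<kappa>\<bar> \<le> 1"
proof -
  have "\<bar>\<kappa> * x\<bar> \<le> 1" if "\<bar>x\<bar> \<le> 1" for x :: real
    using mult_mono[of "\<bar>\<kappa>\<bar>" 1 "\<bar>x\<bar>" 1] that \<open>\<bar>\<kappa>\<bar> \<le> 1\<close> by (simp add: abs_mult)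
  then show ?thesis
    by (auto simp: graph_over_def square_def image_iff complex_eq_iff abs_le_iff)
qed

section \<open>Kinks and bigons\<close>

lemma crossings_in_two_strands:
  assumes sq: "meets_square_in D ({a..b} \<union> {c..d})"
    and p: "graph_strand D a b f p \<sigma>" and q: "graph_strand D c d g q \<tau>"
    and disj: "{a..b} \<inter> {c..d} = {}"
  shows "crossings_in D ({a..b} \<union> {c..d}) = sym_pairs ((\<lambda>x. (p x, q x)) ` meetings f g)"
proof -
  let ?N = "(\<lambda>x. (p x, q x)) ` meetings f g"
  have N: "?N \<subseteq> {a..b} \<times> {c..d}"
    using graph_strandD(5)[OF p] graph_strandD(5)[OF q] by (auto simp: meetings_def)
  have "crossing D s t \<and> s \<in> {a..b} \<union> {c..d} \<longleftrightarrow> (s, t) \<in> ?N \<or> (t, s) \<in> ?N" for s t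
  proof
    assume "crossing D s t \<and> s \<in> {a..b} \<union> {c..d}"
    then show "(s, t) \<in> ?N \<or> (t, s) \<in> ?N"
      using crossing_in_square[OF sq, of s t] no_self_crossing[OF p, of s t] no_self_crossing[OF q, of s t]
        crossing_strands[OF p q disj, of s t] crossing_strands[OF p q disj, of t s] crossing_sym[of D s t]
      by blast
  next
    assume "(s, t) \<in> ?N \<or> (t, s) \<in> ?N"
    then show "crossing D s t \<and> s \<in> {a..b} \<union> {c..d}"
      using crossing_strands[OF p q disj, of s t] crossing_strands[OF p q disj, of t s]
        crossing_sym[of D s t] N by blast
  qed
  then show ?thesis
    unfolding crossings_in_def sym_pairs_def by auto
qed

lemma writhe_polynomial_kink_move:
  fixes D D' :: "('a :: finite) diagram"
  assumes D: "is_diagram D" and D': "is_diagram D'" and "kink_move m D D'"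
  shows "writhe_polynomial D = writhe_polynomial D'"
proof -
  obtain a b s t where ab: "0 < a" "a < b" "b < 1"
    and sq: "meets_square_in D {a..b}" "meets_square_in D' {a..b}"
    and away: "same_away_from a b D D'" and inj: "inj_on (curve D) {a..b}" and st: "s < t"
    and cr: "{(u, v). crossing D' u v \<and> u \<in> {a..b} \<and> v \<in> {a..b}} = {(s, t), (t, s)}"
    using assms(3) unfolding kink_move_def by blast
  have in_D': "crossings_in D' {a..b} = sym_pairs {(s, t)}"
  proof -
    have "crossings_in D' {a..b} = {(u, v). crossing D' u v \<and> u \<in> {a..b} \<and> v \<in> {a..b}}"
      using crossing_in_square[OF sq(2)] by (auto simp only: crossings_in_def)
    then show ?thesis
      unfolding cr by (auto simp: sym_pairs_def)
  qed
  have in_D: "crossings_in D {a..b} = sym_pairs {}"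
  proof -
    have "\<not> crossing D u v" if "u \<in> {a..b}" for u v
    proof
      assume c: "crossing D u v"
      then have "u \<noteq> v" "curve D u = curve D v"
        by (simp_all add: crossing_def)
      then show False
        using inj_onD[OF inj] that crossing_in_square[OF sq(1) c that] by blast
    qed
    then show ?thesis
      by (auto simp: crossings_in_def sym_pairs_def)
  qed
  have "(s, t) \<in> {(u, v). crossing D' u v \<and> u \<in> {a..b} \<and> v \<in> {a..b}}"
    unfolding cr by simp
  then have c: "crossing D' s t" and in_ab: "s \<in> {a..b}" "t \<in> {a..b}"
    by auto
  note weight_D' = weight_inside[OF D' sq(2) _ in_D']
  interpret local_move D D' "{{a..b}}"
  proof (rule local_moveI[OF D D' away ab])
    \<comment> \<open>Both preimages of the new crossing lie on the strand, so the weights of a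
      virtual kink cancel.\<close>
    show "weight D' i J = weight D i J" if "J \<in> {{a..b}}" for i J
      using that in_ab st weight_D'[of J i] weight_inside[OF D sq(1) _ in_D, of J i] by auto
  qed (use sq in \<open>auto simp: pairwise_def is_interval_cc\<close>)
  show ?thesis
  proof (rule writhe_polynomial_local)
    have "both_terms (mark D' s) (chord_sign D' (s, t)) (\<lambda>i. weight D' i {..<s} - weight D' i {..<t}) = 0"
    proof (cases "\<exists>i. mark D' s = Virtual i")
      case False
      \<comment> \<open>A classical kink puts no weight on the strand, so the potential is constant
        there and the chord has index 0.\<close>
      have "weight D' i {..<x} = strand_weight i {a..b}" if "x \<in> {a..b}" for i x
        unfolding weight_lessThan_strand(2)[OF singletonI that]
        by (subst weight_D') (use False st in auto)
      then show ?thesis using in_ab by simp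
    qed auto
    moreover have "{(s, t)} \<inter> {(s, t)}\<inverse> = {}"
      using st by auto
    ultimately show "(\<Sum>(s, t)\<in>crossings_in D (\<Union>{{a..b}}). crossing_term D s t) =
        (\<Sum>(s, t)\<in>crossings_in D' (\<Union>{{a..b}}). crossing_term D' s t)"
      using both_terms_eq[OF D' c] sum_sym_pairs[of "{(s, t)}" "crossing_term D'"]
      by (simp add: in_D in_D') (simp add: sym_pairs_def)
  qed
qed

section \<open>Slopes at zeros, and bigons\<close>

lemma deriv_sign_at_exit:
  fixes g :: "real \<Rightarrow> real"
  assumes der: "(g has_real_derivative d) (at x)" and "g x = 0" and y: "y < x"
    and pos: "\<And>z. y \<le> z \<Longrightarrow> z < x \<Longrightarrow> g z > 0"
  shows "d \<le> 0"
proof (rule ccontr)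
  assume "\<not> d \<le> 0"
  then obtain e where e: "e > 0" "\<And>h. h > 0 \<Longrightarrow> h < e \<Longrightarrow> g (x - h) < g x"
    using DERIV_pos_inc_left[OF der] by force
  define h where "h = min (e / 2) (x - y)"
  have "h > 0" "h < e" "y \<le> x - h"
    using e(1) y by (auto simp: h_def min_def)
  then show False
    using e(2)[of h] pos[of "x - h"] \<open>g x = 0\<close> by simp
qed

lemma deriv_sign_at_entry:
  fixes g :: "real \<Rightarrow> real"
  assumes der: "(g has_real_derivative d) (at x)" and "g x = 0" and y: "x < y"
    and pos: "\<And>z. x < z \<Longrightarrow> z \<le> y \<Longrightarrow> g z > 0"
  shows "d \<ge> 0"
proof -
  have "((\<lambda>z. g (- z)) has_real_derivative - d) (at (- x))"
    using DERIV_mirror[of g d "- x"] der by simp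
  from deriv_sign_at_exit[OF this, of "- y"] show ?thesis
    using assms by simp
qed

lemma no_zero_imp_pos:
  fixes g :: "real \<Rightarrow> real"
  assumes "continuous_on (closed_segment u v) g" "g u > 0" "\<And>z. z \<in> closed_segment u v \<Longrightarrow> g z \<noteq> 0"
  shows "g v > 0"
proof (rule ccontr)
  assume "\<not> g v > 0"
  moreover have "connected (g ` closed_segment u v)"
    using assms(1) by (intro connected_continuous_image connected_segment)
  moreover have "g u \<in> g ` closed_segment u v" "g v \<in> g ` closed_segment u v"
    by auto
  ultimately have "0 \<in> g ` closed_segment u v"
    using connectedD_interval[of "g ` closed_segment u v" "g v" "g u" 0] assms(2) by auto
  then show False using assms(3) by auto
qed

lemma writhe_polynomial_bigon_move:
  fixes D D' :: "('a :: finite) diagram"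
  assumes D: "is_diagram D" and D': "is_diagram D'" and "bigon_move m D D'"
  shows "writhe_polynomial D = writhe_polynomial D'"
proof -
  obtain a b c d f g where disj: "{a..b} \<inter> {c..d} = {}"
    and sq: "meets_square_in D ({a..b} \<union> {c..d})" "meets_square_in D' ({a..b} \<union> {c..d})"
    and away: "same_away_from a b D D'"
    and base: "strand D c d {z \<in> square. Im z = 0}"
    and strand: "strand D a b (graph_over f)" "strand D' a b (graph_over g)"
    and C1: "f C1_differentiable_on {-1..1}" "g C1_differentiable_on {-1..1}"
    and f_pos: "\<And>x. x \<in> {-1..1} \<Longrightarrow> f x > 0" and zeros: "card {x \<in> {-1..1}. g x = 0} = 2"
    and marked: "crossings_marked D' a b m"
    using assms(3) unfolding bigon_move_def by blast
  let ?I = "{a..b} \<union> {c..d}"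
  have "{z \<in> square. Im z = 0} = graph_over (\<lambda>x. 0)"
    using graph_over_line[of 0] by simp
  with base have base: "strand D c d (graph_over (\<lambda>x. 0))"
    by simp
  obtain p0 \<sigma>0 where p0: "graph_strand D a b f p0 \<sigma>0"
    using strand_graph[OF D strand(1) C1(1)] by blast
  obtain p \<sigma> where p: "graph_strand D' a b g p \<sigma>"
    using strand_graph[OF D' strand(2) C1(2)] by blast
  have base_C1: "(\<lambda>x::real. 0::real) C1_differentiable_on {-1..1}" by simp
  obtain q \<tau> where q: "graph_strand D c d (\<lambda>x. 0) q \<tau>"
    using strand_graph[OF D base base_C1] by blast
  have same: "curve D' x = curve D x" if "x \<in> {0..1}" "x \<notin> {a<..<b}" for x
    using away that unfolding same_away_from_def by blast
  note ab = graph_strandD(2-4)[OF p] and cd = graph_strandD(2-4)[OF q]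
  have q': "graph_strand D' c d (\<lambda>x. 0) q \<tau>"
  proof (rule graph_strand_cong[OF q])
    fix t assume t: "t \<in> {c..d}"
    then have "t \<notin> {a..b}" using disj by blast
    then show "curve D' t = curve D t" "tangent D' t = tangent D t"
      using t cd same[of t] tangent_same_away[OF D D' away ab, of t] by auto
  qed
  \<comment> \<open>The curve is unchanged at the parameters \<open>a\<close> and \<open>b\<close>,
    so \<open>g\<close> has the positive end values of \<open>f\<close>.\<close>
  have g_ends: "g (- 1) > 0" "g 1 > 0"
    using graph_strand_ends[OF p0 p] same ab f_pos[of 1] f_pos[of "- 1"] by auto
  obtain x1 x2 where zeros: "{x \<in> {-1..1}. g x = 0} = {x1, x2}" and x12: "x1 < x2"
  proof -
    obtain y z where "{x \<in> {-1..1}. g x = 0} = {y, z}" "y \<noteq> z"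
      using zeros unfolding card_2_iff by blast
    then show ?thesis
      using that[of y z] that[of z y] by (cases y z rule: linorder_cases) (auto simp: insert_commute)
  qed
  have meet: "meetings g (\<lambda>x. 0) = {x1, x2}" "meetings f (\<lambda>x. 0) = {}"
    using zeros f_pos by (force simp: meetings_def)+
  have x: "x1 \<in> {-1..1}" "x2 \<in> {-1..1}" "g x1 = 0" "g x2 = 0"
    using zeros by blast+
  have zero_only: "z = x1 \<or> z = x2" if "z \<in> {-1..1}" "g z = 0" for z
    using that zeros by blast
  have cont: "continuous_on {-1..1} g"
    using C1(2) by (rule C1_differentiable_imp_continuous_on)
  have in_D': "crossings_in D' ?I = sym_pairs {(p x1, q x1), (p x2, q x2)}"
    using crossings_in_two_strands[OF sq(2) p q' disj] by (simp add: meet)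
  have in_D: "crossings_in D ?I = sym_pairs {}"
    using crossings_in_two_strands[OF sq(1) p0 q disj] by (simp add: meet)
  have in_strand: "p y \<in> {a..b}" "p y \<notin> {c..d}" "q y \<in> {c..d}" "q y \<notin> {a..b}" if "y \<in> {-1..1}" for y
    using graph_strandD(5)[OF p that] graph_strandD(5)[OF q that] disj by blast+
  have ne: "p x1 \<noteq> p x2" "q x1 \<noteq> q x2" "p y \<noteq> q z" "q z \<noteq> p y"
    if "y \<in> {-1..1}" "z \<in> {-1..1}" for y z
    using in_strand[OF that(1)] in_strand[OF that(2)] graph_strandD(6)[OF p x(1)] graph_strandD(6)[OF p x(2)]
      graph_strandD(6)[OF q x(1)] graph_strandD(6)[OF q x(2)] x12 by auto
  have cr: "crossing D' (p x1) (q x1)" "crossing D' (p x2) (q x2)"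
    using crossing_strands[OF p q' disj] in_strand x meet by auto
  \<comment> \<open>\<open>g\<close> stays positive from the left edge to its first zero, so its
    slope there is at most 0; transversality of the crossing makes this strict.\<close>
  have slope1: "deriv g x1 < 0"
  proof -
    have "x1 \<noteq> - 1" using x g_ends by auto
    moreover have "g z > 0" if "- 1 \<le> z" "z < x1" for z
    proof (rule no_zero_imp_pos[where u = "- 1" and g = g])
      show "continuous_on (closed_segment (- 1) z) g"
        using that x by (intro continuous_on_subset[OF cont]) (auto simp: closed_segment_eq_real_ivl)
      show "g y \<noteq> 0" if "y \<in> closed_segment (- 1) z" for y
        using that zero_only[of y] \<open>- 1 \<le> z\<close> \<open>z < x1\<close> x x12
          by (auto simp: closed_segment_eq_real_ivl split: if_splits)
    qed (rule g_ends)
    ultimately have "deriv g x1 \<le> 0"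
      using deriv_sign_at_exit[OF C1_real_derivative[OF C1(2) x(1)] x(3), of "- 1"] x(1) by auto
    then show ?thesis
      using strands_transverse[OF D' p q' cr(1) x(1)] by simp
  qed
  have slope2: "deriv g x2 > 0"
  proof -
    have "x2 \<noteq> 1" using x g_ends by auto
    moreover have "g z > 0" if "x2 < z" "z \<le> 1" for z
    proof (rule no_zero_imp_pos[where u = 1 and g = g])
      show "continuous_on (closed_segment 1 z) g"
        using that x by (intro continuous_on_subset[OF cont]) (auto simp: closed_segment_eq_real_ivl)
      show "g y \<noteq> 0" if "y \<in> closed_segment 1 z" for y
        using that zero_only[of y] \<open>x2 < z\<close> \<open>z \<le> 1\<close> x x12
          by (auto simp: closed_segment_eq_real_ivl split: if_splits)
    qed (rule g_ends)
    ultimately have "deriv g x2 \<ge> 0"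
      using deriv_sign_at_entry[OF C1_real_derivative[OF C1(2) x(2)] x(4), of 1] x(2) by auto
    then show ?thesis
      using strands_transverse[OF D' p q' cr(2) x(2)] by simp
  qed
  \<comment> \<open>The base strand has slope 0 and the directions are the same at both crossings,
    so the opposite slopes of \<open>g\<close> give opposite signs.\<close>
  have sign: "chord_sign D' (p x2, q x2) = - chord_sign D' (p x1, q x1)"
    unfolding chord_sign_strands[OF p q' x(1)] chord_sign_strands[OF p q' x(2)]
    using slope1 slope2 graph_strandD(1)[OF p] graph_strandD(1)[OF q] by auto
  have marks: "mark D' (p x1) = m" "mark D' (p x2) = m"
    using marked cr in_strand x unfolding crossings_marked_def by blast+
  have N: "finite {(p x1, q x1), (p x2, q x2)}"
    "{(p x1, q x1), (p x2, q x2)} \<inter> {(p x1, q x1), (p x2, q x2)}\<inverse> = {}"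
    using ne x by auto
  \<comment> \<open>On each strand the two preimages have opposite coefficients, so a whole strand
    has weight 0, as it has in \<open>D\<close>.\<close>
  have weight_D': "weight D' i T = (if m = Virtual i then chord_sign D' (p x1, q x1) *
      (of_bool (q x1 \<in> T) - of_bool (p x1 \<in> T) - of_bool (q x2 \<in> T) + of_bool (p x2 \<in> T)) else 0)"
    if "T \<subseteq> ?I" for i T
    using weight_inside[OF D' sq(2) that in_D' N] ne[OF x(1,1)] by (simp add: marks sign algebra_simps)
  interpret local_move D D' "{{a..b}, {c..d}}"
  proof (rule local_moveI[OF D D' away ab])
    show "weight D' i J = weight D i J" if "J \<in> {{a..b}, {c..d}}" for i J
      using that weight_D'[of J i] weight_inside[OF D sq(1) _ in_D, of J i] in_strand[OF x(1)] in_strand[OF x(2)]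
      by auto
  qed (use sq disj in \<open>auto simp: pairwise_insert disjnt_def is_interval_cc\<close>)
  show ?thesis
  proof (rule writhe_polynomial_local)
    define e where "e = chord_sign D' (p x1, q x1)"
    let ?d = "\<lambda>x i. weight D' i {..<p x} - weight D' i {..<q x}"
    have "both_terms m e (?d x1) + both_terms m (- e) (?d x2) = 0"
    proof (cases "\<exists>i. m = Virtual i")
      case False
      \<comment> \<open>Without virtual crossings in the square the potential is constant along each
        strand. The two chords then have the same index, and their terms cancel by
        \<open>sign\<close>.\<close>
      then have zero: "weight D' i (J \<inter> {y..}) = 0" if "J \<subseteq> ?I" for i J y
        using weight_D'[of "J \<inter> {y..}" i] that by auto
      have "weight D' i {..<y} = strand_weight i {a..b}" if "y \<in> {a..b}" for i y
        using weight_lessThan_strand(2)[OF _ that] zero[of "{a..b}"] by simp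
      moreover have "weight D' i {..<y} = strand_weight i {c..d}" if "y \<in> {c..d}" for i y
        using weight_lessThan_strand(2)[OF _ that] zero[of "{c..d}"] by simp
      ultimately have "?d x1 = ?d x2"
        using in_strand x(1,2) by simp
      then show ?thesis by (simp add: both_terms_cancel)
    qed auto
    then have "(\<Sum>(s, t)\<in>crossings_in D' ?I. crossing_term D' s t) = 0"
      unfolding in_D' sum_sym_pairs[OF N] using both_terms_eq[OF D'] cr ne[OF x(1,1)]
      by (simp add: marks sign e_def)
    then show "(\<Sum>(s, t)\<in>crossings_in D (\<Union>{{a..b}, {c..d}}). crossing_term D s t) =
        (\<Sum>(s, t)\<in>crossings_in D' (\<Union>{{a..b}, {c..d}}). crossing_term D' s t)"
      by (simp add: in_D) (simp add: sym_pairs_def)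
  qed
qed

section \<open>Triangle moves and invariance\<close>

text \<open>The function \<open>x - \<kappa> * f x\<close> is strictly increasing because the slope
  of \<open>f\<close> is below 1 in absolute value, and the bound on \<open>f\<close> makes it
  change sign on the interval. Its value at 0 is \<open>- \<kappa> * f 0\<close>, which tells on
  which side of 0 its zero lies.\<close>

lemma meeting_with_diagonal:
  fixes f :: "real \<Rightarrow> real" and \<kappa> :: real
  assumes C1: "f C1_differentiable_on {-1..1}" and \<kappa>: "\<kappa> = 1 \<or> \<kappa> = - 1"
    and small: "\<And>x. x \<in> {-1..1} \<Longrightarrow> \<bar>f x\<bar> < 1 \<and> \<bar>deriv f x\<bar> < 1"
  obtains x where "meetings f (\<lambda>x. \<kappa> * x) = {x}" "\<kappa> * f 0 > 0 \<longrightarrow> x > 0" "\<kappa> * f 0 < 0 \<longrightarrow> x < 0"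
proof -
  define w where "w x = x - \<kappa> * f x" for x
  have der: "(w has_real_derivative 1 - \<kappa> * deriv f x) (at x)" if "x \<in> {-1..1}" for x
    unfolding w_def using C1_real_derivative[OF C1 that] by (auto intro!: derivative_eq_intros)
  have pos: "1 - \<kappa> * deriv f x > 0" if "x \<in> {-1..1}" for x
    using small[OF that] \<kappa> by auto
  have mono: "w x < w y" if "x \<in> {-1..1}" "y \<in> {-1..1}" "x < y" for x y
  proof (rule DERIV_pos_imp_increasing[OF \<open>x < y\<close>])
    fix z assume "x \<le> z" "z \<le> y"
    then have "z \<in> {-1..1}" using that by auto
    then show "\<exists>l. (w has_real_derivative l) (at z) \<and> l > 0"
      using der pos by blast
  qed
  have "w (- 1) \<le> 0" "w 1 \<ge> 0"
    using small[of 1] small[of "- 1"] \<kappa> by (auto simp: w_def)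
  moreover have "continuous_on {-1..1} w"
    using der by (intro continuous_at_imp_continuous_on ballI) (rule DERIV_isCont)
  ultimately have "\<exists>x\<ge>- 1. x \<le> 1 \<and> w x = 0"
    by (intro IVT') auto
  then obtain x where x: "x \<in> {-1..1}" "w x = 0"
    by auto
  have less_iff: "w y < w z \<longleftrightarrow> y < z" if "y \<in> {-1..1}" "z \<in> {-1..1}" for y z
    using mono[OF that] mono[OF that(2,1)] by (metis less_asym less_linear)
  have "f y = \<kappa> * y \<longleftrightarrow> w y = 0" for y
    using \<kappa> by (auto simp: w_def)
  moreover have "w y = 0 \<longleftrightarrow> y = x" if "y \<in> {-1..1}" for y
    using less_iff[OF that x(1)] less_iff[OF x(1) that] x(2) by (metis less_irrefl linorder_neqE)
  ultimately have "meetings f (\<lambda>x. \<kappa> * x) = {x}"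
    using x(1) by (auto simp: meetings_def)
  moreover have "x > 0" if "\<kappa> * f 0 > 0"
    using less_iff[OF _ x(1), of 0] that x(2) by (simp add: w_def)
  moreover have "x < 0" if "\<kappa> * f 0 < 0"
    using less_iff[OF x(1), of 0] that x(2) by (simp add: w_def)
  ultimately show thesis using that by blast
qed

text \<open>One of the two pictures of a triangle move: index 0 belongs to the moving strand, 1 to
  the rising and 2 to the falling diagonal. Both diagrams are instances with the same diagonals and
  directions, so they can be compared through \<open>xA\<close>, \<open>xB\<close> and
  \<open>p0\<close>.\<close>

locale triangle_position =
  fixes D :: "('a :: finite) diagram" and a b c d e h :: real and f p0 p1 p2 :: "real \<Rightarrow> real"
    and \<sigma>0 \<sigma>1 \<sigma>2 xA xB :: real and m n :: "'a mark"
  assumes D: "is_diagram D"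
    and disj01: "{a..b} \<inter> {c..d} = {}" and disj02: "{a..b} \<inter> {e..h} = {}"
    and disj12: "{c..d} \<inter> {e..h} = {}"
    and sq: "meets_square_in D ({a..b} \<union> {c..d} \<union> {e..h})"
    and s0: "graph_strand D a b f p0 \<sigma>0" and s1: "graph_strand D c d (\<lambda>x. x) p1 \<sigma>1"
    and s2: "graph_strand D e h (\<lambda>x. - x) p2 \<sigma>2"
    and slope: "\<And>x. x \<in> {-1..1} \<Longrightarrow> \<bar>deriv f x\<bar> < 1"
    and xA: "meetings f (\<lambda>x. x) = {xA}" and xB: "meetings f (\<lambda>x. - x) = {xB}"
    and ne: "xA \<noteq> xB"
    and marked: "crossings_marked D a b m" and mark_centre: "mark D (p1 0) = n"
begin

abbreviation strands :: "real set" where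
  "strands \<equiv> {a..b} \<union> {c..d} \<union> {e..h}"

definition pairs :: "(real \<times> real) set" where
  "pairs = {(p0 xA, p1 xA), (p0 xB, p2 xB), (p1 0, p2 0)}"

lemma x_in: "xA \<in> {-1..1}" "xB \<in> {-1..1}" "(0::real) \<in> {-1..1}"
  using xA xB by (auto simp: meetings_def)

lemma meet12: "meetings (\<lambda>x. x) (\<lambda>x. - x) = {0}"
  by (auto simp: meetings_def)

lemma in_strand:
  assumes "x \<in> {-1..1}"
  shows "p0 x \<in> {a..b}" "p0 x \<notin> {c..d}" "p0 x \<notin> {e..h}"
    and "p1 x \<notin> {a..b}" "p1 x \<in> {c..d}" "p1 x \<notin> {e..h}"
    and "p2 x \<notin> {a..b}" "p2 x \<notin> {c..d}" "p2 x \<in> {e..h}"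
  using graph_strandD(5)[OF s0 assms] graph_strandD(5)[OF s1 assms] graph_strandD(5)[OF s2 assms]
    disj01 disj02 disj12 by blast+

lemma pairs_iff:
  "(s, t) \<in> pairs \<longleftrightarrow> crossing D s t \<and>
     (s \<in> {a..b} \<and> t \<in> {c..d} \<or> s \<in> {a..b} \<and> t \<in> {e..h} \<or> s \<in> {c..d} \<and> t \<in> {e..h})"
proof -
  have "crossing D s t \<longleftrightarrow> s = p0 xA \<and> t = p1 xA" if "s \<in> {a..b}" "t \<in> {c..d}"
    using crossing_strands[OF s0 s1 disj01 that] xA by simp
  moreover have "crossing D s t \<longleftrightarrow> s = p0 xB \<and> t = p2 xB" if "s \<in> {a..b}" "t \<in> {e..h}"
    using crossing_strands[OF s0 s2 disj02 that] xB by simp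
  moreover have "crossing D s t \<longleftrightarrow> s = p1 0 \<and> t = p2 0" if "s \<in> {c..d}" "t \<in> {e..h}"
    using crossing_strands[OF s1 s2 disj12 that] meet12 by simp
  moreover have "(s, t) \<in> pairs \<longleftrightarrow> s = p0 xA \<and> t = p1 xA \<or> s = p0 xB \<and> t = p2 xB \<or> s = p1 0 \<and> t = p2 0"
    by (auto simp: pairs_def)
  ultimately show ?thesis
    using in_strand[OF x_in(1)] in_strand[OF x_in(2)] in_strand[OF x_in(3)] by metis
qed

lemma crossings_in_strands: "crossings_in D strands = sym_pairs pairs"
proof -
  have "crossing D s t \<and> s \<in> strands \<longleftrightarrow> (s, t) \<in> pairs \<or> (t, s) \<in> pairs" for s t
    using crossing_in_square[OF sq, of s t] no_self_crossing[OF s0, of s t] no_self_crossing[OF s1, of s t]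
      no_self_crossing[OF s2, of s t] crossing_sym[of D s t]
    unfolding pairs_iff by blast
  then show ?thesis
    unfolding crossings_in_def sym_pairs_def by auto
qed

lemma crossings: "crossing D (p0 xA) (p1 xA)" "crossing D (p0 xB) (p2 xB)" "crossing D (p1 0) (p2 0)"
proof -
  have "(p0 xA, p1 xA) \<in> pairs" "(p0 xB, p2 xB) \<in> pairs" "(p1 0, p2 0) \<in> pairs"
    by (simp_all add: pairs_def)
  then show "crossing D (p0 xA) (p1 xA)" "crossing D (p0 xB) (p2 xB)" "crossing D (p1 0) (p2 0)"
    unfolding pairs_iff by blast+
qed

lemma distinct_points:
  "p0 xA \<noteq> p0 xB" "x \<in> {-1..1} \<Longrightarrow> y \<in> {-1..1} \<Longrightarrow> p0 x \<noteq> p1 y"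
  "x \<in> {-1..1} \<Longrightarrow> y \<in> {-1..1} \<Longrightarrow> p0 x \<noteq> p2 y" "x \<in> {-1..1} \<Longrightarrow> y \<in> {-1..1} \<Longrightarrow> p1 x \<noteq> p2 y"
proof -
  show "p0 xA \<noteq> p0 xB"
    using graph_strandD(6)[OF s0 x_in(1)] graph_strandD(6)[OF s0 x_in(2)] ne by auto
qed (use in_strand in metis)+

lemma pairs_wf: "finite pairs" "pairs \<inter> pairs\<inverse> = {}"
  using distinct_points(1) distinct_points(2,3,4)[OF x_in(1) x_in(1)] distinct_points(2,3,4)[OF x_in(1) x_in(2)]
    distinct_points(2,3,4)[OF x_in(1) x_in(3)] distinct_points(2,3,4)[OF x_in(2) x_in(1)]
    distinct_points(2,3,4)[OF x_in(2) x_in(2)] distinct_points(2,3,4)[OF x_in(2) x_in(3)]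
    distinct_points(2,3,4)[OF x_in(3) x_in(1)] distinct_points(2,3,4)[OF x_in(3) x_in(2)]
    distinct_points(2,3,4)[OF x_in(3) x_in(3)]
  by (auto simp: pairs_def)

lemma sum_pairs: "(\<Sum>(s, t)\<in>pairs. k s t) = k (p0 xA) (p1 xA) + k (p0 xB) (p2 xB) + k (p1 0) (p2 0)"
  unfolding pairs_def using distinct_points(1) distinct_points(2)[OF x_in(1,3)] distinct_points(2)[OF x_in(2,3)]
  by (simp add: add.assoc)

text \<open>As the slope of \<open>f\<close> lies strictly between -1 and 1, the rising diagonal is
  always steeper and the falling one always less steep in the signed sense. Hence the signs do not
  depend on \<open>f\<close>, and the move preserves them.\<close>

lemma signs:
  "chord_sign D (p0 xA, p1 xA) = (if \<sigma>0 * \<sigma>1 > 0 then 1 else - 1)"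
  "chord_sign D (p0 xB, p2 xB) = (if \<sigma>0 * \<sigma>2 > 0 then - 1 else 1)"
proof -
  have "deriv (\<lambda>x::real. x) x = 1" "deriv (\<lambda>x::real. - x) x = - 1" for x
    by (auto intro!: DERIV_imp_deriv derivative_eq_intros)
  then show "chord_sign D (p0 xA, p1 xA) = (if \<sigma>0 * \<sigma>1 > 0 then 1 else - 1)"
    "chord_sign D (p0 xB, p2 xB) = (if \<sigma>0 * \<sigma>2 > 0 then - 1 else 1)"
    using chord_sign_strands[OF s0 s1 x_in(1)] chord_sign_strands[OF s0 s2 x_in(2)]
      slope[OF x_in(1)] slope[OF x_in(2)] graph_strandD(1)[OF s0] graph_strandD(1)[OF s1] graph_strandD(1)[OF s2]
    by auto
qed

lemma marks: "mark D (p0 xA) = m" "mark D (p0 xB) = m"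
  using marked crossings(1,2) in_strand(1)[OF x_in(1)] in_strand(1)[OF x_in(2)]
  unfolding crossings_marked_def by blast+

lemma weight_triangle:
  assumes "T \<subseteq> strands"
  shows "weight D i T =
    (if m = Virtual i then chord_sign D (p0 xA, p1 xA) * (of_bool (p1 xA \<in> T) - of_bool (p0 xA \<in> T)) +
       chord_sign D (p0 xB, p2 xB) * (of_bool (p2 xB \<in> T) - of_bool (p0 xB \<in> T)) else 0) +
    (if n = Virtual i then chord_sign D (p1 0, p2 0) * (of_bool (p2 0 \<in> T) - of_bool (p1 0 \<in> T)) else 0)"
  unfolding weight_inside[OF D sq assms crossings_in_strands pairs_wf] sum_pairs
  by (simp add: marks mark_centre)

text \<open>A whole strand contains its preimages wherever they lie on it, so only marks and signs
  enter, not the abscissas \<open>xA\<close> and \<open>xB\<close>.\<close>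

lemma weight_strands:
  "weight D i {a..b} = (if m = Virtual i then - chord_sign D (p0 xA, p1 xA) - chord_sign D (p0 xB, p2 xB) else 0)"
  "weight D i {c..d} = (if m = Virtual i then chord_sign D (p0 xA, p1 xA) else 0) -
     (if n = Virtual i then chord_sign D (p1 0, p2 0) else 0)"
  "weight D i {e..h} = (if m = Virtual i then chord_sign D (p0 xB, p2 xB) else 0) +
     (if n = Virtual i then chord_sign D (p1 0, p2 0) else 0)"
proof -
  have sub: "{a..b} \<subseteq> strands" "{c..d} \<subseteq> strands" "{e..h} \<subseteq> strands" by blast+
  note mem = in_strand[OF x_in(1)] in_strand[OF x_in(2)] in_strand[OF x_in(3)]
  show "weight D i {a..b} = (if m = Virtual i then - chord_sign D (p0 xA, p1 xA) - chord_sign D (p0 xB, p2 xB) else 0)"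
    unfolding weight_triangle[OF sub(1)] by (simp only: mem of_bool_eq simp_thms) simp
  show "weight D i {c..d} = (if m = Virtual i then chord_sign D (p0 xA, p1 xA) else 0) -
      (if n = Virtual i then chord_sign D (p1 0, p2 0) else 0)"
    unfolding weight_triangle[OF sub(2)] by (simp only: mem of_bool_eq simp_thms) simp
  show "weight D i {e..h} = (if m = Virtual i then chord_sign D (p0 xB, p2 xB) else 0) +
      (if n = Virtual i then chord_sign D (p1 0, p2 0) else 0)"
    unfolding weight_triangle[OF sub(3)] by (simp only: mem of_bool_eq simp_thms) simp
qed

lemma sum_crossing_terms:
  "(\<Sum>(s, t)\<in>crossings_in D strands. crossing_term D s t) =
    both_terms m (chord_sign D (p0 xA, p1 xA)) (\<lambda>i. weight D i {..<p0 xA} - weight D i {..<p1 xA}) +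
    both_terms m (chord_sign D (p0 xB, p2 xB)) (\<lambda>i. weight D i {..<p0 xB} - weight D i {..<p2 xB}) +
    both_terms n (chord_sign D (p1 0, p2 0)) (\<lambda>i. weight D i {..<p1 0} - weight D i {..<p2 0})"
  unfolding crossings_in_strands sum_sym_pairs[OF pairs_wf] sum_pairs
  by (simp add: both_terms_eq[OF D] crossings marks mark_centre)

text \<open>This measures the potential at the centre along each diagonal. The crossing at the
  centre is classical and has no weight, so the only question is whether the diagonal meets the
  moving strand after the centre.\<close>

lemma weight_from_centre:
  assumes "\<And>i. n \<noteq> Virtual i"
  shows "weight D i ({c..d} \<inter> {p1 0..}) =
      (if m = Virtual i \<and> \<sigma>1 * xA \<ge> 0 then chord_sign D (p0 xA, p1 xA) else 0)"
    and "weight D i ({e..h} \<inter> {p2 0..}) =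
      (if m = Virtual i \<and> \<sigma>2 * xB \<ge> 0 then chord_sign D (p0 xB, p2 xB) else 0)"
proof -
  define S T where "S = {c..d} \<inter> {p1 0..}" and "T = {e..h} \<inter> {p2 0..}"
  have sub: "S \<subseteq> strands" "T \<subseteq> strands"
    unfolding S_def T_def by blast+
  have "p1 xA \<in> S \<longleftrightarrow> \<sigma>1 * xA \<ge> 0" "p2 xB \<in> T \<longleftrightarrow> \<sigma>2 * xB \<ge> 0"
    using graph_strandD(8)[OF s1 x_in(1,3)] graph_strandD(8)[OF s2 x_in(2,3)]
      in_strand(5)[OF x_in(1)] in_strand(9)[OF x_in(2)] by (auto simp: S_def T_def)
  moreover have "p0 xA \<notin> S" "p0 xB \<notin> S" "p2 xB \<notin> S" "p0 xA \<notin> T" "p0 xB \<notin> T" "p1 xA \<notin> T"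
    unfolding S_def T_def using in_strand[OF x_in(1)] in_strand[OF x_in(2)] by blast+
  ultimately show
    "weight D i S = (if m = Virtual i \<and> \<sigma>1 * xA \<ge> 0 then chord_sign D (p0 xA, p1 xA) else 0)"
    "weight D i T = (if m = Virtual i \<and> \<sigma>2 * xB \<ge> 0 then chord_sign D (p0 xB, p2 xB) else 0)"
    unfolding weight_triangle[OF sub(1)] weight_triangle[OF sub(2)] using assms[of i]
    by (simp_all cong: if_cong)
qed

end

text \<open>The hypothesis \<open>mn\<close> excludes a strand with classical crossings that slides
  across a virtual crossing. There the potential of a diagonal would jump at the centre, between the
  old and the new position of its crossing with the moving strand.\<close>

lemma writhe_polynomial_triangle_move:
  fixes D D' :: "('a :: finite) diagram"
  assumes D: "is_diagram D" and D': "is_diagram D'" and "triangle_move m n D D'"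
    and mn: "m \<in> {Over, Under} \<Longrightarrow> n \<in> {Over, Under}"
  shows "writhe_polynomial D = writhe_polynomial D'"
proof -
  obtain a b c d e h f g where
    disj: "{a..b} \<inter> {c..d} = {}" "{a..b} \<inter> {e..h} = {}" "{c..d} \<inter> {e..h} = {}"
    and sq: "meets_square_in D ({a..b} \<union> {c..d} \<union> {e..h})" "meets_square_in D' ({a..b} \<union> {c..d} \<union> {e..h})"
    and away: "same_away_from a b D D'"
    and diag: "strand D c d {z \<in> square. Im z = Re z}" "strand D e h {z \<in> square. Im z = - Re z}"
    and strand: "strand D a b (graph_over f)" "strand D' a b (graph_over g)"
    and C1: "f C1_differentiable_on {-1..1}" "g C1_differentiable_on {-1..1}"
    and small: "\<And>x. x \<in> {-1..1} \<Longrightarrow> \<bar>f x\<bar> < 1 \<and> \<bar>deriv f x\<bar> < 1 \<and> \<bar>g x\<bar> < 1 \<and> \<bar>deriv g x\<bar> < 1"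
    and centre: "f 0 > 0" "g 0 < 0"
    and marked: "crossings_marked D a b m" "crossings_marked D' a b m"
    and mark_centre: "\<And>t. t \<in> {c..d} \<Longrightarrow> curve D t = 0 \<Longrightarrow> mark D t = n"
    using assms(3) unfolding triangle_move_def by blast
  have diag: "strand D c d (graph_over (\<lambda>x. x))" "strand D e h (graph_over (\<lambda>x. - x))"
    using diag graph_over_line[of 1] graph_over_line[of "- 1"] by simp_all
  have diag_C1: "(\<lambda>x::real. x) C1_differentiable_on {-1..1}" "(\<lambda>x::real. - x) C1_differentiable_on {-1..1}"
    by simp_all
  obtain p0 \<sigma>0 where p0: "graph_strand D a b f p0 \<sigma>0"
    using strand_graph[OF D strand(1) C1(1)] by blast
  obtain q0 \<sigma>0' where q0': "graph_strand D' a b g q0 \<sigma>0'"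
    using strand_graph[OF D' strand(2) C1(2)] by blast
  obtain p1 \<sigma>1 where p1: "graph_strand D c d (\<lambda>x. x) p1 \<sigma>1"
    using strand_graph[OF D diag(1) diag_C1(1)] by blast
  obtain p2 \<sigma>2 where p2: "graph_strand D e h (\<lambda>x. - x) p2 \<sigma>2"
    using strand_graph[OF D diag(2) diag_C1(2)] by blast
  have same: "curve D' x = curve D x" if "x \<in> {0..1}" "x \<notin> {a<..<b}" for x
    using away that unfolding same_away_from_def by blast
  note ab = graph_strandD(2-4)[OF p0] and cd = graph_strandD(2-4)[OF p1] and eh = graph_strandD(2-4)[OF p2]
  have "\<sigma>0' = \<sigma>0"
    using graph_strand_ends(1)[OF p0 q0'] same ab by auto
  with q0' have q0: "graph_strand D' a b g q0 \<sigma>0"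
    by simp
  have q1: "graph_strand D' c d (\<lambda>x. x) p1 \<sigma>1"
  proof (rule graph_strand_cong[OF p1])
    fix t assume t: "t \<in> {c..d}"
    then have "t \<notin> {a..b}" using disj by blast
    then show "curve D' t = curve D t" "tangent D' t = tangent D t"
      using t cd same[of t] tangent_same_away[OF D D' away ab, of t] by auto
  qed
  have q2: "graph_strand D' e h (\<lambda>x. - x) p2 \<sigma>2"
  proof (rule graph_strand_cong[OF p2])
    fix t assume t: "t \<in> {e..h}"
    then have "t \<notin> {a..b}" using disj by blast
    then show "curve D' t = curve D t" "tangent D' t = tangent D t"
      using t eh same[of t] tangent_same_away[OF D D' away ab, of t] by auto
  qed
  \<comment> \<open>Passing from above the centre to below it carries the crossing with either
    diagonal to the other side of the centre.\<close>
  obtain xA where xA: "meetings f (\<lambda>x. x) = {xA}" "xA > 0"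
    using meeting_with_diagonal[OF C1(1), of 1] small centre by auto
  obtain xB where xB: "meetings f (\<lambda>x. - x) = {xB}" "xB < 0"
    using meeting_with_diagonal[OF C1(1), of "- 1"] small centre by auto
  obtain yA where yA: "meetings g (\<lambda>x. x) = {yA}" "yA < 0"
    using meeting_with_diagonal[OF C1(2), of 1] small centre by auto
  obtain yB where yB: "meetings g (\<lambda>x. - x) = {yB}" "yB > 0"
    using meeting_with_diagonal[OF C1(2), of "- 1"] small centre by auto
  have zero_in: "(0::real) \<in> {-1..1}" by simp
  have n: "mark D (p1 0) = n"
    using mark_centre[OF graph_strandD(5)[OF p1 zero_in]] graph_strandD(6)[OF p1 zero_in]
    by (simp add: complex_eq_iff)
  have "p1 0 \<notin> {a..b}" "p2 0 \<notin> {a..b}" "crossing D (p1 0) (p2 0)"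
    using graph_strandD(5)[OF p1 zero_in] graph_strandD(5)[OF p2 zero_in] disj
      crossing_strands[OF p1 p2 disj(3)] by (auto simp: meetings_def)
  \<comment> \<open>\<open>same_away_from\<close> preserves the marks of a crossing only if both its
    preimages lie off the moving strand, so both preimages of the centre are checked.\<close>
  then have n': "mark D' (p1 0) = n"
    using away n unfolding same_away_from_def by blast
  interpret T: triangle_position D a b c d e h f p0 p1 p2 \<sigma>0 \<sigma>1 \<sigma>2 xA xB m n
    using D disj sq(1) p0 p1 p2 small xA xB marked(1) n by unfold_locales auto
  interpret T': triangle_position D' a b c d e h g q0 p1 p2 \<sigma>0 \<sigma>1 \<sigma>2 yA yB m n
    using D' disj sq(2) q0 q1 q2 small yA yB marked(2) n' by unfold_locales auto
  have eA: "chord_sign D' (q0 yA, p1 yA) = chord_sign D (p0 xA, p1 xA)"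
    and eB: "chord_sign D' (q0 yB, p2 yB) = chord_sign D (p0 xB, p2 xB)"
    by (simp_all add: T.signs T'.signs)
  have eC: "chord_sign D' (p1 0, p2 0) = chord_sign D (p1 0, p2 0)"
    unfolding chord_sign_strands[OF p1 p2 zero_in] chord_sign_strands[OF q1 q2 zero_in] ..
  have U: "\<Union>{{a..b}, {c..d}, {e..h}} = T.strands"
    by (simp add: Un_assoc)
  interpret local_move D D' "{{a..b}, {c..d}, {e..h}}"
  proof (rule local_moveI[OF D D' away ab])
    show "weight D' i J = weight D i J" if "J \<in> {{a..b}, {c..d}, {e..h}}" for i J
      using that by (auto simp: T.weight_strands T'.weight_strands eA eB eC)
    show "pairwise disjnt {{a..b}, {c..d}, {e..h}}"
      unfolding pairwise_def disjnt_def using disj by blast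
    show "meets_square_in D (\<Union>{{a..b}, {c..d}, {e..h}})" "meets_square_in D' (\<Union>{{a..b}, {c..d}, {e..h}})"
      unfolding U by (fact sq)+
  qed (auto simp: is_interval_cc)
  have J: "{a..b} \<in> {{a..b}, {c..d}, {e..h}}" "{c..d} \<in> {{a..b}, {c..d}, {e..h}}"
    "{e..h} \<in> {{a..b}, {c..d}, {e..h}}" by simp_all
  note potential = J[THEN weight_lessThan_strand(1)] J[THEN weight_lessThan_strand(2)]
  note sums = U T.sum_crossing_terms T'.sum_crossing_terms eA eB eC
  show ?thesis
  proof (rule writhe_polynomial_local)
    consider i j where "m = Virtual i" "n = Virtual j"
      | i where "m = Virtual i" "\<And>j. n \<noteq> Virtual j"
      | "\<And>j. m \<noteq> Virtual j" "\<And>j. n \<noteq> Virtual j"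
      using mn by (cases m; cases n) auto
    then show "(\<Sum>(s, t)\<in>crossings_in D (\<Union>{{a..b}, {c..d}, {e..h}}). crossing_term D s t) =
        (\<Sum>(s, t)\<in>crossings_in D' (\<Union>{{a..b}, {c..d}, {e..h}}). crossing_term D' s t)"
    proof cases
      case 1
      then show ?thesis unfolding sums by simp
    next
      case 2
      text \<open>Moving the strand across the centre changes the potential at the centre by the
        same amount, \<open>\<sigma>0\<close>, on both diagonals.\<close>
      have "weight D' i {..<p1 0} - weight D' i {..<p2 0} = weight D i {..<p1 0} - weight D i {..<p2 0}" for i
        unfolding potential(2,5)[OF T.in_strand(5)[OF zero_in]] potential(3,6)[OF T.in_strand(9)[OF zero_in]]
          T.weight_from_centre[OF 2(2)] T'.weight_from_centre[OF 2(2)] eA eB T.signs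
        using xA(2) xB(2) yA(2) yB(2)
          graph_strandD(1)[OF p0] graph_strandD(1)[OF p1] graph_strandD(1)[OF p2]
        by auto
      then show ?thesis unfolding sums using 2(1) by simp
    next
      case 3
      \<comment> \<open>All crossings in the square are classical, so the potential is constant
        along each strand and every index depends only on which two strands cross.\<close>
      have zero: "weight D i (J \<inter> {y..}) = 0" "weight D' i (J \<inter> {y..}) = 0" if "J \<subseteq> T.strands" for i J y
      proof -
        have sub: "J \<inter> {y..} \<subseteq> T.strands" using that by blast
        show "weight D i (J \<inter> {y..}) = 0" "weight D' i (J \<inter> {y..}) = 0"
          unfolding T.weight_triangle[OF sub] T'.weight_triangle[OF sub] using 3 by simp_all
      qed
      have zero_strand: "weight D i ({a..b} \<inter> {y..}) = 0" "weight D' i ({a..b} \<inter> {y..}) = 0"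
        "weight D i ({c..d} \<inter> {y..}) = 0" "weight D' i ({c..d} \<inter> {y..}) = 0"
        "weight D i ({e..h} \<inter> {y..}) = 0" "weight D' i ({e..h} \<inter> {y..}) = 0" for i y
        by (rule zero, blast)+
      note const = potential[unfolded zero_strand diff_0_right]
      show ?thesis
        unfolding sums
          const(1)[OF T.in_strand(1)[OF T.x_in(1)]] const(1)[OF T.in_strand(1)[OF T.x_in(2)]]
          const(4)[OF T'.in_strand(1)[OF T'.x_in(1)]] const(4)[OF T'.in_strand(1)[OF T'.x_in(2)]]
          const(2,5)[OF T.in_strand(5)[OF zero_in]] const(3,6)[OF T.in_strand(9)[OF zero_in]]
          const(2)[OF T.in_strand(5)[OF T.x_in(1)]] const(3)[OF T.in_strand(9)[OF T.x_in(2)]]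
          const(5)[OF T'.in_strand(5)[OF T'.x_in(1)]] const(6)[OF T'.in_strand(9)[OF T'.x_in(2)]] ..
    qed
  qed
qed

section \<open>Invariance under all moves and on equivalence classes\<close>

lemma writhe_polynomial_move:
  fixes D D' :: "('a :: finite) diagram"
  assumes D: "is_diagram D" and D': "is_diagram D'" and "move D D'"
  shows "writhe_polynomial D = writhe_polynomial D'"
  using assms(3)
proof cases
  case Reparametrization
  then show ?thesis by (rule writhe_polynomial_reparametrized[OF D D'])
next
  case Isotopy
  then show ?thesis by (rule writhe_polynomial_isotoped[OF D D'])
next
  case (Omega1 m)
  then show ?thesis using writhe_polynomial_kink_move[OF D D'] by blast
next
  case (Omega2 m)
  then show ?thesis using writhe_polynomial_bigon_move[OF D D'] by blast
next
  case (Omega3 m n)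
  then show ?thesis using writhe_polynomial_triangle_move[OF D D'] by blast
next
  case (Omega1v i)
  then show ?thesis by (rule writhe_polynomial_kink_move[OF D D'])
next
  case (Omega2v i)
  then show ?thesis by (rule writhe_polynomial_bigon_move[OF D D'])
next
  case (Omega3v i j)
  then show ?thesis by (rule writhe_polynomial_triangle_move[OF D D']) simp
next
  case (Omega3cv i n)
  then show ?thesis using writhe_polynomial_triangle_move[OF D D'] by blast
qed

lemma writhe_polynomial_equivalent:
  fixes D D' :: "('a :: finite) diagram"
  assumes "equivalent D D'"
  shows "writhe_polynomial D = writhe_polynomial D'"
  using assms unfolding equivalent_def
proof (induction rule: equivclp_induct)
  case base
  then show ?case by simp
next
  case (step E E')
  \<comment> \<open>A step of the generated equivalence may be a move in either direction.\<close>
  then show ?case using writhe_polynomial_move by metis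
qed

theorem theorem3p2:
  fixes K :: "('a :: finite) diagram set" and D D' :: "'a diagram"
  assumes "K \<in> multi_virtual_knots"
    and "D \<in> K" and "D' \<in> K"
  shows "writhe_polynomial D = writhe_polynomial D'"
proof -
  obtain E where "K = {(D, D'). is_diagram D \<and> is_diagram D' \<and> equivalent D D'} `` {E}"
    using assms(1) unfolding multi_virtual_knots_def by (rule quotientE)
  then have "equivalent E D" "equivalent E D'"
    using assms(2,3) by auto
  then show ?thesis
    using writhe_polynomial_equivalent by metis
qed

end
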